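(* Let $U$ be an optimal machine. For probabilistic algorithms $A$ (deciding $\mathrm{dom}(U)$ approximately) we still have: (a) $\underline{E}(A)>0$ for every $A$; (b) there exists $\varepsilon>0$ such that $\overline{E}(A)\ge \varepsilon$ for every $A$.
   Context: A machine is a partial computable function from binary strings to binary strings; for a machine $V$ let $C_V(x)=\min\{|p|\colon V(p)=x\}$ (plain Kolmogorov complexity with respect to $V$). $U$ is optimal if for every machine $V$ there is $c$ with $C_U(x)\le C_V(x)+c$ for all $x$. A randomized algorithm $A$ uses fair coin tosses; on input $x$ it errs if $x\in\mathrm{dom}(U)$ and it does not output $1$, or $x\notin\mathrm{dom}(U)$ and it does not output $0$ (no answer counts as an error). $\varepsilon_n(A)$ is the probability of error on a random input uniformly distributed among all strings of length at most $n$ (the random bits of $A$ independent of the input choice); $\overline{E}(A)=\limsup_n\varepsilon_n(A)$, $\underline{E}(A)=\liminf_n\varepsilon_n(A)$. *)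

theory Defs
  imports "HOL-Analysis.Analysis" "HOL-Library.Extended_Nat"
begin

datatype recf = Zf | Sf | Proj nat | Cn recf "recf list" | Pr recf recf | Mn recf

inductive ev :: "recf \<Rightarrow> nat list \<Rightarrow> nat \<Rightarrow> bool" where
  ev_Z: "ev Zf xs 0"
| ev_S: "ev Sf (x # xs) (Suc x)"
| ev_Proj: "i < length xs \<Longrightarrow> ev (Proj i) xs (xs ! i)"
| ev_Cn: "list_all2 (\<lambda>g y. ev g xs y) gs ys \<Longrightarrow> ev f ys z \<Longrightarrow> ev (Cn f gs) xs z"
| ev_Pr0: "ev f xs y \<Longrightarrow> ev (Pr f g) (0 # xs) y"
| ev_PrS: "ev (Pr f g) (n # xs) y \<Longrightarrow> ev g (y # n # xs) z \<Longrightarrow> ev (Pr f g) (Suc n # xs) z"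
| ev_Mn: "ev f (n # xs) 0 \<Longrightarrow> (\<forall>m<n. \<exists>y. ev f (m # xs) (Suc y)) \<Longrightarrow> ev (Mn f) xs n"

text \<open>Bijective encoding of binary strings as natural numbers.\<close>
fun enc :: "bool list \<Rightarrow> nat" where
  "enc [] = 0"
| "enc (b # s) = 2 * enc s + (if b then 2 else 1)"

definition machine :: "(bool list \<Rightarrow> bool list option) \<Rightarrow> bool" where
  "machine V \<longleftrightarrow> (\<exists>f. \<forall>x n. ev f [enc x] n \<longleftrightarrow> (\<exists>y. V x = Some y \<and> n = enc y))"

text \<open>Plain complexity w.r.t. V (infinite if x has no description).\<close>
definition Cplx :: "(bool list \<Rightarrow> bool list option) \<Rightarrow> bool list \<Rightarrow> enat" where
  "Cplx V x = (INF p \<in> {p. V p = Some x}. enat (length p))"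

definition optimal :: "(bool list \<Rightarrow> bool list option) \<Rightarrow> bool" where
  "optimal U \<longleftrightarrow> machine U \<and>
     (\<forall>V. machine V \<longrightarrow> (\<exists>c::nat. \<forall>x. Cplx U x \<le> Cplx V x + enat c))"

text \<open>A randomized algorithm is described by a total computable function
  A x r giving the state after the coin tosses r (a finite bit string) on input x:
  None = no output yet, Some y = halted with output y. Once halted, further
  coin tosses do not change the result.\<close>
definition randomized_algorithm :: "(bool list \<Rightarrow> bool list \<Rightarrow> bool list option) \<Rightarrow> bool" where
  "randomized_algorithm A \<longleftrightarrow>
     (\<exists>f. \<forall>x r n. ev f [enc x, enc r] n \<longleftrightarrow>
            n = (case A x r of None \<Rightarrow> 0 | Some y \<Rightarrow> Suc (enc y))) \<and>
     (\<forall>x r s. A x r \<noteq> None \<longrightarrow> A x (r @ s) = A x r)"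

definition prob_out :: "(bool list \<Rightarrow> bool list \<Rightarrow> bool list option) \<Rightarrow> bool list \<Rightarrow> bool list \<Rightarrow> real" where
  "prob_out A x y = (SUP k. real (card {r::bool list. length r = k \<and> A x r = Some y}) / 2 ^ k)"

definition answer :: "(bool list \<Rightarrow> bool list option) \<Rightarrow> bool list \<Rightarrow> bool list" where
  "answer U x = (if x \<in> dom U then [True] else [False])"

definition err :: "(bool list \<Rightarrow> bool list option) \<Rightarrow> (bool list \<Rightarrow> bool list \<Rightarrow> bool list option) \<Rightarrow> bool list \<Rightarrow> real" where
  "err U A x = 1 - prob_out A x (answer U x)"

definition eps :: "(bool list \<Rightarrow> bool list option) \<Rightarrow> (bool list \<Rightarrow> bool list \<Rightarrow> bool list option) \<Rightarrow> nat \<Rightarrow> real" where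
  "eps U A n = (\<Sum>x\<in>{x::bool list. length x \<le> n}. err U A x) / real (card {x::bool list. length x \<le> n})"

end

theory Submission
  imports Defs
begin

text \<open>The number \<open>H\<close> of halting programs of length at most \<open>n\<close> is incompressible: knowing it, one
  waits until all of them have halted and finds a string of complexity above \<open>n\<close>. Hence no
  computable function of \<open>n\<close> and \<open>k\<close> can approximate \<open>H\<close> up to \<open>2 ^ (n - 2 * k)\<close> for large \<open>k\<close>.
  If the error of \<open>A\<close> is small at \<open>n\<close>, then running \<open>A\<close> on all inputs until it is unlikely to be still
  silent, and adding up the frequencies of the answer 1, gives such an approximation; this is (a). For (b)
  the approximating function must not depend on \<open>A\<close>: if the error is small at all large \<open>n\<close>, one
  chooses a length \<open>n\<close> that itself encodes a \<open>U\<close>-program for the approximations produced by \<open>A\<close>.\<close>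

section \<open>Total recursive functions\<close>

text \<open>The offset correcting an approximation costs n - 2 * k + O(1) bits and naming k costs k
  more, so the description has n - k + O(1) bits; this is why the tolerance has 2 * k in the
  exponent. The gain of k bits must beat the additive constant of optimality, which depends on the
  approximating program. In (a) that program contains \<open>A\<close>, and so the bound varies with
  \<open>A\<close>. In (b) it refers only to \<open>U\<close>; the constant belonging to
  \<open>A\<close> affects just the length of a \<open>U\<close>-program for a table of
  approximations, and is absorbed by taking long inputs. All constructed functions must be shown
  computable in the calculus \<open>recf\<close>. Each construction simulates only fixed programs,
  so clocked evaluation is shown recursive for one program at a time, and optimality of
  \<open>U\<close> supplies the universality.\<close>

lemma ev_Zf_iff [simp]: "ev Zf xs y \<longleftrightarrow> y = 0"
  by (auto elim: ev.cases intro: ev.intros)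

lemma ev_Sf_iff: "ev Sf xs y \<longleftrightarrow> xs \<noteq> [] \<and> y = Suc (hd xs)"
  by (cases xs) (auto elim: ev.cases intro: ev.intros)

lemma ev_Proj_iff [simp]: "ev (Proj i) xs y \<longleftrightarrow> i < length xs \<and> y = xs ! i"
  by (auto elim: ev.cases intro: ev.intros)

lemma ev_Cn_iff: "ev (Cn f gs) xs z \<longleftrightarrow> (\<exists>ys. list_all2 (\<lambda>g y. ev g xs y) gs ys \<and> ev f ys z)"
  by (auto elim: ev.cases intro: ev.intros)

lemma ev_Pr_0_iff [simp]: "ev (Pr f g) (0 # xs) z \<longleftrightarrow> ev f xs z"
  by (auto elim: ev.cases intro: ev.intros)

lemma ev_Pr_Suc_iff:
  "ev (Pr f g) (Suc n # xs) z \<longleftrightarrow> (\<exists>y. ev (Pr f g) (n # xs) y \<and> ev g (y # n # xs) z)"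
  by (auto elim: ev.cases intro: ev.intros)

lemma ev_Mn_iff:
  "ev (Mn f) xs n \<longleftrightarrow> ev f (n # xs) 0 \<and> (\<forall>m<n. \<exists>y. ev f (m # xs) (Suc y))"
  by (auto elim: ev.cases intro: ev.intros)

definition total_rec :: "nat \<Rightarrow> (nat list \<Rightarrow> nat) \<Rightarrow> bool" where
  "total_rec n F \<longleftrightarrow> (\<exists>f. \<forall>xs. length xs = n \<longrightarrow> (\<forall>y. ev f xs y \<longleftrightarrow> y = F xs))"

text \<open>The default 0 makes every projection total, so \<open>total_rec_arg\<close> holds for
  all indices without length conditions.\<close>

definition arg :: "nat list \<Rightarrow> nat \<Rightarrow> nat" where
  "arg e i = (if i < length e then e ! i else 0)"

lemma arg_tl: "arg (tl e) i = arg e (Suc i)"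
  by (cases e) (auto simp: arg_def)

lemma arg_Cons [simp]: "arg (x # e) 0 = x" "arg (x # e) (Suc i) = arg e i"
  by (auto simp: arg_def)

lemma total_rec_cong:
  assumes "total_rec n F" "\<And>xs. length xs = n \<Longrightarrow> F xs = G xs"
  shows "total_rec n G"
  using assms unfolding total_rec_def by auto

section \<open>Closure under composition and primitive recursion\<close>

lemma total_rec_comp_list:
  assumes F: "total_rec (length Gs) F" and Gs: "\<And>G. G \<in> set Gs \<Longrightarrow> total_rec n G"
  shows "total_rec n (\<lambda>e. F (map (\<lambda>G. G e) Gs))"
proof -
  obtain f where f: "\<And>xs y. length xs = length Gs \<Longrightarrow> ev f xs y \<longleftrightarrow> y = F xs"
    using F unfolding total_rec_def by blast
  have "\<exists>g. \<forall>xs. length xs = n \<longrightarrow> (\<forall>y. ev g xs y \<longleftrightarrow> y = G xs)" if "G \<in> set Gs" for G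
    using Gs[OF that] unfolding total_rec_def .
  then obtain c where c: "\<And>G xs y. G \<in> set Gs \<Longrightarrow> length xs = n \<Longrightarrow> ev (c G) xs y \<longleftrightarrow> y = G xs"
    by metis
  have "list_all2 (\<lambda>g y. ev g xs y) (map c Gs) ys \<longleftrightarrow> ys = map (\<lambda>G. G xs) Gs"
    if "length xs = n" for xs ys
    using c[OF _ that] by (auto simp: list_all2_conv_all_nth list_eq_iff_nth_eq)
  then have "ev (Cn f (map c Gs)) xs y \<longleftrightarrow> y = F (map (\<lambda>G. G xs) Gs)" if "length xs = n" for xs y
    using that f by (simp add: ev_Cn_iff)
  then show ?thesis unfolding total_rec_def by blast
qed

lemma total_rec_const: "total_rec n (\<lambda>e. c)"
proof (induction c)
  case 0
  then show ?case unfolding total_rec_def by (intro exI[of _ Zf]) simp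
next
  case (Suc c)
  have "total_rec (length [\<lambda>e::nat list. c]) (\<lambda>e. Suc (hd e))"
    unfolding total_rec_def by (intro exI[of _ Sf]) (auto simp: ev_Sf_iff)
  from total_rec_comp_list[OF this, of n] Suc show ?case by simp
qed

lemma total_rec_arg: "total_rec n (\<lambda>e. arg e i)"
proof (cases "i < n")
  case True
  then show ?thesis
    unfolding total_rec_def arg_def by (intro exI[of _ "Proj i"]) auto
next
  case False
  then show ?thesis
    by (intro total_rec_cong[OF total_rec_const[of n 0]]) (auto simp: arg_def)
qed

lemma total_rec_comp1:
  assumes "total_rec 1 (\<lambda>e. F (arg e 0))" "total_rec n a"
  shows "total_rec n (\<lambda>e. F (a e))"
  using total_rec_comp_list[of "[a]" "\<lambda>e. F (arg e 0)" n] assms by simp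

lemma total_rec_comp2:
  assumes "total_rec 2 (\<lambda>e. F (arg e 0) (arg e 1))" "total_rec n a" "total_rec n b"
  shows "total_rec n (\<lambda>e. F (a e) (b e))"
  using total_rec_comp_list[of "[a, b]" "\<lambda>e. F (arg e 0) (arg e 1)" n] assms
  by (auto simp: numeral_2_eq_2)

lemma total_rec_comp3:
  assumes "total_rec 3 (\<lambda>e. F (arg e 0) (arg e 1) (arg e 2))"
    and "total_rec n a" "total_rec n b" "total_rec n c"
  shows "total_rec n (\<lambda>e. F (a e) (b e) (c e))"
  using total_rec_comp_list[of "[a, b, c]" "\<lambda>e. F (arg e 0) (arg e 1) (arg e 2)" n] assms
  by (auto simp: numeral_3_eq_3 numeral_2_eq_2)

lemma total_rec_Suc: "total_rec n a \<Longrightarrow> total_rec n (\<lambda>e. Suc (a e))"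
  by (rule total_rec_comp1[where F = Suc])
    (auto simp: total_rec_def ev_Sf_iff arg_def hd_conv_nth intro!: exI[of _ Sf])

text \<open>Environments work as with de Bruijn indices: a bound variable is the new head, the
  surrounding parameters are the tail. Here a computed value is substituted for that
  variable.\<close>

lemma total_rec_hd_tl:
  assumes "total_rec (Suc n) (\<lambda>e. F (arg e 0) (tl e))" "total_rec n a"
  shows "total_rec n (\<lambda>e. F (a e) e)"
proof -
  let ?Gs = "a # map (\<lambda>i e. arg e i) [0..<n]"
  have "total_rec n (\<lambda>e. (\<lambda>e. F (arg e 0) (tl e)) (map (\<lambda>G. G e) ?Gs))"
    using assms by (intro total_rec_comp_list) (auto simp: total_rec_arg)
  moreover have "map (\<lambda>G. G e) (map (\<lambda>i e. arg e i) [0..<n]) = e" if "length e = n" for e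
    using that by (auto simp: list_eq_iff_nth_eq arg_def)
  ultimately show ?thesis
    by (elim total_rec_cong) simp
qed

lemma total_rec_rec_nat:
  assumes a: "total_rec n a"
    and g: "total_rec (Suc (Suc n)) (\<lambda>e. g (arg e 0) (arg e 1) (tl (tl e)))"
    and b: "total_rec n b"
  shows "total_rec n (\<lambda>e. rec_nat (a e) (\<lambda>i y. g y i e) (b e))"
proof (rule total_rec_hd_tl[OF _ b])
  obtain fa where fa: "\<And>xs y. length xs = n \<Longrightarrow> ev fa xs y \<longleftrightarrow> y = a xs"
    using a unfolding total_rec_def by blast
  obtain fg where fg: "\<And>xs y. length xs = Suc (Suc n) \<Longrightarrow>
      ev fg xs y \<longleftrightarrow> y = g (arg xs 0) (arg xs 1) (tl (tl xs))"
    using g unfolding total_rec_def by blast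
  have pr: "ev (Pr fa fg) (m # xs) y \<longleftrightarrow> y = rec_nat (a xs) (\<lambda>i y. g y i xs) m"
    if "length xs = n" for m xs y
    using that
  proof (induction m arbitrary: y)
    case 0
    then show ?case by (simp add: fa)
  next
    case (Suc m)
    then show ?case by (simp add: ev_Pr_Suc_iff fg)
  qed
  have "ev (Pr fa fg) ys y \<longleftrightarrow> y = rec_nat (a (tl ys)) (\<lambda>i y. g y i (tl ys)) (arg ys 0)"
    if "length ys = Suc n" for ys y
    using that pr by (cases ys) auto
  then show "total_rec (Suc n) (\<lambda>e. rec_nat (a (tl e)) (\<lambda>i y. g y i (tl e)) (arg e 0))"
    unfolding total_rec_def by blast
qed

section \<open>Arithmetic\<close>

lemma total_rec_add:
  assumes "total_rec n a" "total_rec n b"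
  shows "total_rec n (\<lambda>e. a e + b e)"
proof (rule total_rec_cong)
  show "total_rec n (\<lambda>e. rec_nat (a e) (\<lambda>i y. Suc y) (b e))"
    by (intro total_rec_rec_nat total_rec_Suc total_rec_arg assms)
  have "rec_nat x (\<lambda>i y. Suc y) m = x + m" for x m by (induction m) auto
  then show "rec_nat (a e) (\<lambda>i y. Suc y) (b e) = a e + b e" for e by simp
qed

lemma total_rec_mult:
  assumes "total_rec n a" "total_rec n b"
  shows "total_rec n (\<lambda>e. a e * b e)"
proof (rule total_rec_comp2[OF _ assms], rule total_rec_cong)
  show "total_rec 2 (\<lambda>e. rec_nat 0 (\<lambda>i y. y + arg e 0) (arg e 1))"
    by (intro total_rec_rec_nat, unfold arg_tl)
      (intro total_rec_add total_rec_arg total_rec_const)+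
  have "rec_nat 0 (\<lambda>i y. y + x) m = x * m" for x m :: nat by (induction m) auto
  then show "rec_nat 0 (\<lambda>i y. y + arg e 0) (arg e 1) = arg e 0 * arg e 1" for e by simp
qed

lemma total_rec_power:
  assumes "total_rec n a" "total_rec n b"
  shows "total_rec n (\<lambda>e. a e ^ b e)"
proof (rule total_rec_comp2[OF _ assms], rule total_rec_cong)
  show "total_rec 2 (\<lambda>e. rec_nat 1 (\<lambda>i y. y * arg e 0) (arg e 1))"
    by (intro total_rec_rec_nat, unfold arg_tl)
      (intro total_rec_mult total_rec_arg total_rec_const)+
  have "rec_nat 1 (\<lambda>i y. y * x) m = x ^ m" for x m :: nat by (induction m) auto
  then show "rec_nat 1 (\<lambda>i y. y * arg e 0) (arg e 1) = arg e 0 ^ arg e 1" for e by simp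
qed

lemma total_rec_diff:
  assumes "total_rec n a" "total_rec n b"
  shows "total_rec n (\<lambda>e. a e - b e)"
proof (rule total_rec_comp2[OF _ assms], rule total_rec_cong)
  have p: "total_rec 1 (\<lambda>e. arg e 0 - 1)"
  proof (rule total_rec_cong)
    show "total_rec 1 (\<lambda>e. rec_nat 0 (\<lambda>i y. i) (arg e 0))"
      by (intro total_rec_rec_nat total_rec_arg total_rec_const)
    show "rec_nat 0 (\<lambda>i y. i) (arg e 0) = arg e 0 - 1" for e
      by (cases "arg e 0") auto
  qed
  show "total_rec 2 (\<lambda>e. rec_nat (arg e 0) (\<lambda>i y. y - 1) (arg e 1))"
    by (intro total_rec_rec_nat total_rec_arg total_rec_comp1[OF p])
  have "rec_nat x (\<lambda>i y. y - 1) m = x - m" for x m :: nat by (induction m) auto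
  then show "rec_nat (arg e 0) (\<lambda>i y. y - 1) (arg e 1) = arg e 0 - arg e 1" for e by simp
qed

text \<open>Weakening for nested binders: a body expecting one variable in front of the parameters
  is used below two of them, reading the counter of a recursion (\<open>k = 1\<close>) or the
  innermost bound variable (\<open>k = 0\<close>).\<close>

lemma total_rec_drop_second:
  assumes F: "total_rec (Suc n) (\<lambda>e. F (arg e 0) (tl e))"
  shows "total_rec (Suc (Suc n)) (\<lambda>e. F (arg e k) (tl (tl e)))"
proof (rule total_rec_cong)
  let ?Gs = "(\<lambda>e. arg e k) # map (\<lambda>i e. arg e (Suc (Suc i))) [0..<n]"
  show "total_rec (Suc (Suc n)) (\<lambda>e. (\<lambda>e. F (arg e 0) (tl e)) (map (\<lambda>G. G e) ?Gs))"
    using F by (intro total_rec_comp_list) (auto simp: total_rec_arg)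
  show "(\<lambda>e. F (arg e 0) (tl e)) (map (\<lambda>G. G e) ?Gs) = F (arg e k) (tl (tl e))"
    if e: "length e = Suc (Suc n)" for e
  proof -
    have "map (\<lambda>G. G e) (map (\<lambda>i e. arg e (Suc (Suc i))) [0..<n]) = tl (tl e)"
      using e by (auto simp: list_eq_iff_nth_eq arg_def nth_tl)
    then show ?thesis by simp
  qed
qed

lemma total_rec_sum:
  fixes h :: "nat \<Rightarrow> nat list \<Rightarrow> nat"
  assumes h: "total_rec (Suc n) (\<lambda>e. h (arg e 0) (tl e))" and "total_rec n b"
  shows "total_rec n (\<lambda>e. \<Sum>i<b e. h i e)"
proof (rule total_rec_cong)
  have "total_rec (Suc (Suc n)) (\<lambda>e. h (arg e 1) (tl (tl e)))"
    by (rule total_rec_drop_second[OF h])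
  then show "total_rec n (\<lambda>e. rec_nat 0 (\<lambda>i y. y + h i e) (b e))"
    by (intro total_rec_rec_nat total_rec_add total_rec_arg total_rec_const assms)
  have "rec_nat 0 (\<lambda>i y. y + h i e) m = (\<Sum>i<m. h i e)" for m e by (induction m) auto
  then show "rec_nat 0 (\<lambda>i y. y + h i e) (b e) = (\<Sum>i<b e. h i e)" for e by simp
qed

section \<open>Decidable predicates as functions with values 0 and 1\<close>

lemma total_rec_le:
  assumes "total_rec n a" "total_rec n b"
  shows "total_rec n (\<lambda>e. of_bool (a e \<le> b e))"
  by (rule total_rec_cong[of _ "\<lambda>e. 1 - (a e - b e)"])
    (auto intro!: total_rec_diff total_rec_const assms simp: of_bool_def)

lemma total_rec_less:
  assumes "total_rec n a" "total_rec n b"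
  shows "total_rec n (\<lambda>e. of_bool (a e < b e))"
  unfolding Suc_le_eq[symmetric] by (intro total_rec_le total_rec_Suc assms)

lemma total_rec_not:
  assumes "total_rec n (\<lambda>e. of_bool (P e))"
  shows "total_rec n (\<lambda>e. of_bool (\<not> P e))"
  by (rule total_rec_cong[of _ "\<lambda>e. 1 - of_bool (P e)"])
    (auto intro!: total_rec_diff total_rec_const assms)

lemma total_rec_conj:
  assumes "total_rec n (\<lambda>e. of_bool (P e))" "total_rec n (\<lambda>e. of_bool (Q e))"
  shows "total_rec n (\<lambda>e. of_bool (P e \<and> Q e))"
  by (rule total_rec_cong[of _ "\<lambda>e. of_bool (P e) * of_bool (Q e)"])
    (auto intro!: total_rec_mult assms)

lemma total_rec_eq:
  assumes "total_rec n a" "total_rec n b"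
  shows "total_rec n (\<lambda>e. of_bool (a e = b e))"
  by (rule total_rec_cong[of _ "\<lambda>e. of_bool (a e \<le> b e \<and> b e \<le> a e)"])
    (auto intro!: total_rec_conj total_rec_le assms simp: eq_iff)

lemma total_rec_if:
  assumes "total_rec n (\<lambda>e. of_bool (P e))" "total_rec n a" "total_rec n b"
  shows "total_rec n (\<lambda>e. if P e then a e else b e)"
  by (rule total_rec_cong[of _ "\<lambda>e. of_bool (P e) * a e + of_bool (\<not> P e) * b e"])
    (auto intro!: total_rec_add total_rec_mult total_rec_not assms)

lemma total_rec_ball:
  assumes "total_rec (Suc n) (\<lambda>e. of_bool (P (arg e 0) (tl e)))" "total_rec n b"
  shows "total_rec n (\<lambda>e. of_bool (\<forall>i<b e. P i e))"
proof (rule total_rec_cong)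
  show "total_rec n (\<lambda>e. of_bool ((\<Sum>i<b e. of_bool (\<not> P i e)) = (0::nat)))"
    by (intro total_rec_eq total_rec_sum total_rec_not total_rec_const assms)
qed (rule arg_cong[where f = of_bool], auto)

text \<open>Bounded minimisation; a failed search returns the bound, so
  \<open>bleast P b < b\<close> tests for success.\<close>

primrec bleast :: "(nat \<Rightarrow> bool) \<Rightarrow> nat \<Rightarrow> nat" where
  "bleast P 0 = 0"
| "bleast P (Suc b) = (if bleast P b < b then bleast P b else if P b then b else Suc b)"

lemma bleast_le: "bleast P b \<le> b"
  by (induction b) auto

lemma bleast_below: "i < bleast P b \<Longrightarrow> \<not> P i"
proof (induction b arbitrary: i)
  case (Suc b)
  then show ?case
    using bleast_le[of P b] by (auto split: if_splits simp: less_Suc_eq)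
qed simp

lemma bleast_holds: "bleast P b < b \<Longrightarrow> P (bleast P b)"
proof (induction b)
  case (Suc b)
  then show ?case
    using bleast_le[of P b] by (auto split: if_splits)
qed simp

lemma bleast_eqI:
  assumes "P m" "m < b" "\<And>i. i < m \<Longrightarrow> \<not> P i"
  shows "bleast P b = m"
proof -
  have "\<not> m < bleast P b" using bleast_below assms(1) by blast
  moreover from this have "P (bleast P b)" using assms(2) by (intro bleast_holds[of P b]) simp
  ultimately show ?thesis using assms(3) by (meson linorder_neqE_nat)
qed

text \<open>The least witness is the number of \<open>j\<close> below the bound such that no
  \<open>i \<le> j\<close> is a witness. This reduces the search to sums and bounded
  quantifiers.\<close>

lemma total_rec_bleast:
  assumes "total_rec (Suc n) (\<lambda>e. of_bool (P (arg e 0) (tl e)))" "total_rec n b"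
  shows "total_rec n (\<lambda>e. bleast (\<lambda>i. P i e) (b e))"
proof (rule total_rec_cong)
  have count: "bleast Q m = (\<Sum>j<m. of_bool (\<forall>i<Suc j. \<not> Q i))" for Q m
  proof (induction m)
    case (Suc m)
    have "(\<forall>i<Suc m. \<not> Q i) \<longleftrightarrow> \<not> bleast Q m < m \<and> \<not> Q m"
      using bleast_le[of Q m] bleast_below[of _ Q m] bleast_holds[of Q m]
      by (metis le_neq_implies_less less_Suc_eq)
    with Suc bleast_le[of Q m] show ?case by (simp only: sum.lessThan_Suc bleast.simps) auto
  qed simp
  have "total_rec (Suc (Suc n)) (\<lambda>e. of_bool (P (arg e 0) (tl (tl e))))"
    by (rule total_rec_drop_second[OF assms(1)])
  then show "total_rec n (\<lambda>e. \<Sum>j<b e. of_bool (\<forall>i<Suc j. \<not> P i e))"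
    by (intro total_rec_sum total_rec_ball total_rec_not total_rec_Suc total_rec_arg assms)
  show "(\<Sum>j<b e. of_bool (\<forall>i<Suc j. \<not> P i e)) = bleast (\<lambda>i. P i e) (b e)" for e
    by (simp only: count)
qed

lemmas total_rec_intros =
  total_rec_const total_rec_arg total_rec_Suc total_rec_add total_rec_mult total_rec_power
  total_rec_diff total_rec_sum total_rec_le total_rec_less total_rec_not total_rec_conj
  total_rec_eq total_rec_if total_rec_ball total_rec_bleast

lemma total_rec_div:
  assumes "total_rec n a" "total_rec n b"
  shows "total_rec n (\<lambda>e. a e div b e)"
proof (rule total_rec_cong)
  show "total_rec n (\<lambda>e. if b e = 0 then 0 else bleast (\<lambda>q. a e < b e * Suc q) (Suc (a e)))"
    by (rule total_rec_comp2[where F = "\<lambda>x y. if y = 0 then 0 else bleast (\<lambda>q. x < y * Suc q) (Suc x)",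
        OF _ assms])
      (rule total_rec_intros | unfold arg_tl)+
  show "(if b e = 0 then 0 else bleast (\<lambda>q. a e < b e * Suc q) (Suc (a e))) = a e div b e" for e
  proof (cases "b e = 0")
    case False
    have "bleast (\<lambda>q. a e < b e * Suc q) (Suc (a e)) = a e div b e"
    proof (rule bleast_eqI)
      show "a e < b e * Suc (a e div b e)" using False dividend_less_times_div[of "b e" "a e"] by simp
      show "a e div b e < Suc (a e)" using div_le_dividend by (simp add: less_Suc_eq_le)
      show "\<not> a e < b e * Suc q" if "q < a e div b e" for q
      proof -
        have "b e * Suc q \<le> b e * (a e div b e)" using that by (intro mult_le_mono2) simp
        also have "\<dots> \<le> a e" by simp
        finally show ?thesis by simp
      qed
    qed
    with False show ?thesis by simp
  qed simp
qed

lemma total_rec_mod: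
  assumes "total_rec n a" "total_rec n b"
  shows "total_rec n (\<lambda>e. a e mod b e)"
  unfolding minus_mult_div_eq_mod[symmetric]
  by (intro total_rec_diff total_rec_mult total_rec_div assms)

text \<open>All programs built later have this shape: wait for the first stage satisfying a
  decidable condition, then compute from it. \<open>Mn\<close> stops at the value 0, so it is
  applied to the negated condition; if no stage succeeds, the program diverges.\<close>

lemma recf_search:
  assumes P: "total_rec (Suc n) (\<lambda>e. of_bool (P (arg e 0) (tl e)))"
    and out: "total_rec (Suc n) (\<lambda>e. out (arg e 0) (tl e))"
  obtains f where "\<And>xs y. length xs = n \<Longrightarrow>
    ev f xs y \<longleftrightarrow> (\<exists>t. P t xs \<and> (\<forall>s<t. \<not> P s xs) \<and> y = out t xs)"
proof -
  obtain fp where fp: "\<And>xs y. length xs = Suc n \<Longrightarrow> ev fp xs y \<longleftrightarrow> y = of_bool (\<not> P (arg xs 0) (tl xs))"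
    using total_rec_not[OF P] unfolding total_rec_def by blast
  obtain fo where fo: "\<And>xs y. length xs = Suc n \<Longrightarrow> ev fo xs y \<longleftrightarrow> y = out (arg xs 0) (tl xs)"
    using out unfolding total_rec_def by blast
  have mn: "ev (Mn fp) xs t \<longleftrightarrow> P t xs \<and> (\<forall>s<t. \<not> P s xs)" if "length xs = n" for xs t
    using that by (simp add: ev_Mn_iff fp of_bool_def) blast
  let ?f = "Cn fo (Mn fp # map Proj [0..<n])"
  have proj: "list_all2 (\<lambda>g y. ev g xs y) (map Proj [0..<n]) ys \<longleftrightarrow> ys = xs"
    if "length xs = n" for xs ys
    using that by (auto simp: list_all2_conv_all_nth list_eq_iff_nth_eq)
  have "ev ?f xs y \<longleftrightarrow> (\<exists>t. P t xs \<and> (\<forall>s<t. \<not> P s xs) \<and> y = out t xs)"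
    if "length xs = n" for xs y
    using that by (auto simp: ev_Cn_iff list_all2_Cons1 proj mn fo)
  then show thesis using that by blast
qed

section \<open>Clocked evaluation\<close>

text \<open>The value 0 means that the evaluation does not succeed with clock \<open>s\<close>; \<open>Suc y\<close> stands for the
  result \<open>y\<close>. The clock only bounds the searches.\<close>

fun clk :: "recf \<Rightarrow> nat \<Rightarrow> nat list \<Rightarrow> nat" where
  "clk Zf s xs = 1"
| "clk Sf s xs = (if xs = [] then 0 else Suc (Suc (arg xs 0)))"
| "clk (Proj i) s xs = (if i < length xs then Suc (arg xs i) else 0)"
| "clk (Cn f gs) s xs =
    (if \<forall>g\<in>set gs. clk g s xs \<noteq> 0 then clk f s (map (\<lambda>g. clk g s xs - 1) gs) else 0)"
| "clk (Pr f g) s xs =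
    (if xs = [] then 0
     else rec_nat (clk f s (tl xs))
       (\<lambda>i y. if y = 0 then 0 else clk g s ((y - 1) # i # tl xs)) (arg xs 0))"
| "clk (Mn f) s xs =
    (let m = bleast (\<lambda>m. clk f s (m # xs) \<le> 1) s
     in if m < s \<and> clk f s (m # xs) = 1 then Suc m else 0)"

lemma clk_Pr_Cons: "clk (Pr f g) s (n # zs) =
    rec_nat (clk f s zs) (\<lambda>i y. if y = 0 then 0 else clk g s ((y - 1) # i # zs)) n"
  by (simp only: clk.simps list.distinct if_False list.sel arg_Cons)

lemma clk_mono: "clk f s xs \<noteq> 0 \<Longrightarrow> s \<le> s' \<Longrightarrow> clk f s' xs = clk f s xs"
proof (induction f arbitrary: xs)
  case (Cn f gs)
  have "\<forall>g\<in>set gs. clk g s' xs = clk g s xs"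
    using Cn by (auto split: if_splits)
  moreover from this have "map (\<lambda>g. clk g s' xs - 1) gs = map (\<lambda>g. clk g s xs - 1) gs" by simp
  ultimately show ?case using Cn by (auto split: if_splits simp del: map_eq_conv)
next
  case (Pr f g)
  let ?R = "\<lambda>s. rec_nat (clk f s (tl xs))
       (\<lambda>i y. if y = 0 then 0 else clk g s ((y - 1) # i # tl xs))"
  have "?R s n \<noteq> 0 \<Longrightarrow> ?R s' n = ?R s n" for n
  proof (induction n)
    case 0
    then show ?case using Pr by simp
  next
    case (Suc n)
    then have "?R s n \<noteq> 0" by (auto split: if_splits)
    with Suc Pr show ?case by simp
  qed
  with Pr.prems show ?case by (simp split: if_splits)
next
  case (Mn f)
  define m where "m = bleast (\<lambda>m. clk f s (m # xs) \<le> 1) s"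
  from Mn.prems have m: "m < s" "clk f s (m # xs) = 1" and eq: "clk (Mn f) s xs = Suc m"
    by (auto simp: m_def Let_def split: if_splits)
  \<comment> \<open>The test \<open>\<le> 1\<close> catches 0 (no value within the clock) as well as
    1 (the value zero). So all arguments below \<open>m\<close> already have positive values at
    clock \<open>s\<close>, and a larger clock cannot reveal an earlier zero.\<close>
  have below: "\<not> clk f s (i # xs) \<le> 1" if "i < m" for i
    using that bleast_below[of i "\<lambda>m. clk f s (m # xs) \<le> 1" s] unfolding m_def by simp
  have "bleast (\<lambda>m. clk f s' (m # xs) \<le> 1) s' = m"
  proof (rule bleast_eqI)
    show "clk f s' (m # xs) \<le> 1" using Mn m by simp
    show "m < s'" using m Mn.prems by simp
    show "\<not> clk f s' (i # xs) \<le> 1" if "i < m" for i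
      using below[OF that] Mn by (cases "clk f s (i # xs) = 0") auto
  qed
  moreover have "clk f s' (m # xs) = 1" using Mn m by simp
  ultimately show ?case using eq m Mn.prems by simp
qed auto

lemma clk_sound: "clk f s xs = Suc y \<Longrightarrow> ev f xs y"
proof (induction f arbitrary: xs y)
  case (Sf xs)
  then show ?case by (cases xs) (auto simp: ev_Sf_iff split: if_splits)
next
  case (Cn f gs)
  then have "\<forall>g\<in>set gs. clk g s xs \<noteq> 0" "clk f s (map (\<lambda>g. clk g s xs - 1) gs) = Suc y"
    by (auto split: if_splits)
  moreover from this have "list_all2 (\<lambda>g y. ev g xs y) gs (map (\<lambda>g. clk g s xs - 1) gs)"
    using Cn.IH(2) by (auto simp: list_all2_conv_all_nth)
  ultimately show ?case using Cn.IH(1) by (blast intro: ev_Cn)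
next
  case (Pr f g)
  then obtain n zs where xs: "xs = n # zs" by (cases xs) auto
  let ?R = "rec_nat (clk f s zs) (\<lambda>i y. if y = 0 then 0 else clk g s ((y - 1) # i # zs))"
  have "?R n = Suc y \<Longrightarrow> ev (Pr f g) (n # zs) y" for n y
  proof (induction n arbitrary: y)
    case 0
    then show ?case using Pr by (auto intro: ev_Pr0)
  next
    case (Suc n)
    then obtain y' where y': "?R n = Suc y'" "clk g s (y' # n # zs) = Suc y"
      by (auto split: if_splits simp: gr0_conv_Suc)
    then show ?case using Suc.IH Pr.IH(2) by (auto intro: ev_PrS)
  qed
  with Pr.prems xs show ?case by (simp only: clk_Pr_Cons)
next
  case (Mn f)
  define m where "m = bleast (\<lambda>m. clk f s (m # xs) \<le> 1) s"
  from Mn.prems have m: "clk f s (m # xs) = Suc 0" and y: "y = m"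
    by (auto simp: m_def Let_def split: if_splits)
  have "\<exists>z. ev f (i # xs) (Suc z)" if "i < m" for i
  proof -
    have "\<not> clk f s (i # xs) \<le> 1"
      using that bleast_below[of i "\<lambda>m. clk f s (m # xs) \<le> 1" s] unfolding m_def by simp
    then obtain z where "clk f s (i # xs) = Suc (Suc z)"
      by (metis One_nat_def not_less_eq_eq le0 not0_implies_Suc)
    then show ?thesis using Mn.IH by blast
  qed
  with m y Mn.IH show ?case by (auto intro: ev_Mn)
qed (auto simp: arg_def split: if_splits)

lemma clk_Suc_mono: "clk f s xs = Suc y \<Longrightarrow> s \<le> s' \<Longrightarrow> clk f s' xs = Suc y"
  using clk_mono[of f s xs s'] by simp

lemma ex_uniform_bound:
  fixes n :: nat
  assumes "\<forall>i<n. \<exists>s. Q i s" "\<And>i s s'. Q i s \<Longrightarrow> s \<le> s' \<Longrightarrow> Q i s'"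
  shows "\<exists>s::nat. \<forall>i<n. Q i s"
  using assms(1)
proof (induction n)
  case (Suc n)
  then obtain s s' where "\<forall>i<n. Q i s" "Q n s'" by auto
  then have "\<forall>i<Suc n. Q i (max s s')"
    using assms(2) by (metis less_Suc_eq max.cobounded1 max.cobounded2)
  then show ?case by blast
qed simp

lemma clk_complete: "ev f xs y \<Longrightarrow> \<exists>s. clk f s xs = Suc y"
proof (induction rule: ev.induct)
  case (ev_Cn xs gs ys f z)
  have len: "length gs = length ys"
    using ev_Cn.IH(1) by (simp add: list_all2_lengthD)
  have "\<exists>s. \<forall>i<length gs. clk (gs ! i) s xs = Suc (ys ! i)"
    using ev_Cn.IH(1) by (intro ex_uniform_bound) (auto simp: list_all2_conv_all_nth intro: clk_Suc_mono)
  then obtain s where s: "\<forall>i<length gs. clk (gs ! i) s xs = Suc (ys ! i)" by blast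
  obtain s' where s': "clk f s' ys = Suc z" using ev_Cn.IH by blast
  let ?t = "max s s'"
  have t: "\<forall>i<length gs. clk (gs ! i) ?t xs = Suc (ys ! i)"
    using s by (auto intro: clk_Suc_mono)
  then have "\<forall>g\<in>set gs. clk g ?t xs \<noteq> 0"
    by (metis in_set_conv_nth nat.distinct(1))
  moreover have "map (\<lambda>g. clk g ?t xs - 1) gs = ys"
    using t len by (intro nth_equalityI) auto
  moreover have "clk f ?t ys = Suc z" using s' by (auto intro: clk_Suc_mono)
  ultimately show ?case by (intro exI[of _ ?t]) simp
next
  case (ev_PrS f g n xs y z)
  then obtain s s' where s: "clk (Pr f g) s (n # xs) = Suc y" "clk g s' (y # n # xs) = Suc z" by blast
  let ?t = "max s s'"
  have "clk (Pr f g) ?t (n # xs) = Suc y" "clk g ?t (y # n # xs) = Suc z"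
    using s by (auto intro: clk_Suc_mono simp del: clk.simps)
  then show ?case by (intro exI[of _ ?t]) (simp add: clk_Pr_Cons del: clk.simps)
next
  case (ev_Mn f n xs)
  obtain s where s: "clk f s (n # xs) = 1" using ev_Mn by auto
  have "\<exists>s. \<forall>i<n. 1 < clk f s (i # xs)"
  proof (intro ex_uniform_bound allI impI)
    show "\<exists>s. 1 < clk f s (i # xs)" if "i < n" for i
    proof -
      from ev_Mn(3) that obtain y where "\<exists>s. clk f s (i # xs) = Suc (Suc y)" by blast
      then obtain s where "clk f s (i # xs) = Suc (Suc y)" by blast
      then show ?thesis by (intro exI[of _ s]) simp
    qed
    show "1 < clk f s' (i # xs)" if "1 < clk f s (i # xs)" "s \<le> s'" for i s s'
      using clk_mono[of f s "i # xs" s'] that by simp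
  qed
  then obtain s' where s': "\<forall>i<n. 1 < clk f s' (i # xs)" by blast
  \<comment> \<open>The search in \<open>clk\<close> is bounded by the clock itself, which must
    therefore exceed the witness \<open>n\<close>.\<close>
  define t where "t = max (Suc n) (max s s')"
  have tn: "clk f t (n # xs) = 1"
    using clk_mono[of f s "n # xs" t] s by (simp add: t_def)
  have "bleast (\<lambda>m. clk f t (m # xs) \<le> 1) t = n"
  proof (rule bleast_eqI)
    show "clk f t (n # xs) \<le> 1" using tn by simp
    show "n < t" by (simp add: t_def)
    show "\<not> clk f t (i # xs) \<le> 1" if "i < n" for i
      using clk_mono[of f s' "i # xs" t] s' that by (fastforce simp: t_def)
  qed
  with tn show ?case by (intro exI[of _ t]) (simp add: t_def)
qed (auto simp: arg_def)

lemma ev_iff_clk: "ev f xs y \<longleftrightarrow> (\<exists>s. clk f s xs = Suc y)"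
  using clk_sound clk_complete by blast

lemma ev_fun: "ev f xs y \<Longrightarrow> ev f xs z \<Longrightarrow> y = z"
  unfolding ev_iff_clk by (metis clk_Suc_mono nat.inject nle_le)

lemma total_rec_comp_tuple:
  assumes F: "total_rec m F" and G: "\<And>i. i < m \<Longrightarrow> total_rec n (G i)"
    and H: "\<And>e. length e = n \<Longrightarrow> length (H e) = m \<and> (\<forall>i<m. H e ! i = G i e)"
  shows "total_rec n (\<lambda>e. F (H e))"
proof (rule total_rec_cong)
  show "total_rec n (\<lambda>e. F (map (\<lambda>h. h e) (map G [0..<m])))"
    using F G by (intro total_rec_comp_list) auto
  show "F (map (\<lambda>h. h e) (map G [0..<m])) = F (H e)" if "length e = n" for e
    using H[OF that] by (intro arg_cong[where f = F]) (auto simp: list_eq_iff_nth_eq)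
qed

lemma total_rec_list_ball:
  assumes "\<And>g. g \<in> set gs \<Longrightarrow> total_rec n (\<lambda>e. of_bool (P g e))"
  shows "total_rec n (\<lambda>e. of_bool (\<forall>g\<in>set gs. P g e))"
  using assms
proof (induction gs)
  case (Cons g gs)
  then show ?case using total_rec_conj[of n "P g" "\<lambda>e. \<forall>g\<in>set gs. P g e"] by simp
qed (auto simp: total_rec_const)

text \<open>The basis of every simulation below: \<open>f\<close> is fixed while clock and input
  vary. The arity is generalised because \<open>Cn\<close>, \<open>Pr\<close> and \<open>Mn\<close>
  call subprograms on lists of other lengths.\<close>

lemma total_rec_clk: "total_rec (Suc n) (\<lambda>e. clk f (arg e 0) (tl e))"
proof (induction f arbitrary: n)
  case Zf
  then show ?case by (simp add: total_rec_const[of _ 1, simplified])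
next
  case Sf
  show ?case
    by (rule total_rec_cong[of _ "\<lambda>e. if n = 0 then 0 else Suc (Suc (arg e 1))"])
      ((rule total_rec_intros)+, auto simp: arg_tl simp flip: length_0_conv)
next
  case (Proj i)
  show ?case
    by (rule total_rec_cong[of _ "\<lambda>e. if i < n then Suc (arg e (Suc i)) else 0"])
      ((rule total_rec_intros)+, auto simp: arg_tl)
next
  case (Cn f gs)
  have "total_rec (Suc n) (\<lambda>e. clk f (arg (arg e 0 # map (\<lambda>g. clk g (arg e 0) (tl e) - 1) gs) 0)
      (tl (arg e 0 # map (\<lambda>g. clk g (arg e 0) (tl e) - 1) gs)))"
  proof (rule total_rec_comp_tuple[OF Cn.IH(1)[of "length gs"],
        where G = "\<lambda>i e. if i = 0 then arg e 0 else clk (gs ! (i - 1)) (arg e 0) (tl e) - 1"])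
    show "total_rec (Suc n) (\<lambda>e. if i = 0 then arg e 0 else clk (gs ! (i - 1)) (arg e 0) (tl e) - 1)"
      if "i < Suc (length gs)" for i
      using that by (cases i) (auto intro!: total_rec_arg total_rec_diff total_rec_const[of _ 1, simplified] Cn.IH(2))
  qed (auto simp: nth_Cons')
  then have c: "total_rec (Suc n) (\<lambda>e. clk f (arg e 0) (map (\<lambda>g. clk g (arg e 0) (tl e) - 1) gs))"
    by (simp only: arg_Cons list.sel)
  show ?case unfolding clk.simps
    by (intro total_rec_if total_rec_list_ball total_rec_not total_rec_eq total_rec_const Cn.IH c)
next
  case (Pr f g)
  have f: "total_rec (Suc n) (\<lambda>e. clk f (arg e 0) (tl (tl e)))" for n
  proof (cases n)
    case 0
    show ?thesis unfolding 0
      by (rule total_rec_cong[of _ "\<lambda>e. clk f (arg e 0) (tl e)"])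
        (auto intro: Pr.IH simp: length_Suc_conv)
  next
    case (Suc n')
    then show ?thesis using total_rec_drop_second[OF Pr.IH(1)[of n'], of 0] by simp
  qed
  \<comment> \<open>The environment is accumulator, counter, clock, recursion argument, remaining
    parameters; hence \<open>arg e 2\<close> is the clock and four tails reach the remaining
    parameters.\<close>
  have g: "total_rec (Suc (Suc (Suc n)))
      (\<lambda>e. clk g (arg e 2) ((arg e 0 - 1) # arg e 1 # tl (tl (tl (tl e)))))"
  proof (cases n)
    case 0
    have "total_rec (Suc (Suc (Suc n))) (\<lambda>e. clk g (arg [arg e 2, arg e 0 - 1, arg e 1] 0)
        (tl [arg e 2, arg e 0 - 1, arg e 1]))"
      by (rule total_rec_comp_tuple[OF Pr.IH(2)[of 2], where G = "\<lambda>i e. if i = 0 then arg e 2 else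
            if i = 1 then arg e 0 - 1 else arg e 1"])
        (auto intro!: total_rec_intros simp: less_Suc_eq numeral_2_eq_2 simp del: One_nat_def)
    then show ?thesis by (rule total_rec_cong) (auto simp: 0 length_Suc_conv)
  next
    case (Suc n')
    have "total_rec (Suc (Suc (Suc n))) (\<lambda>e.
        clk g (arg (arg e 2 # (arg e 0 - 1) # arg e 1 # tl (tl (tl (tl e)))) 0)
        (tl (arg e 2 # (arg e 0 - 1) # arg e 1 # tl (tl (tl (tl e))))))"
      by (rule total_rec_comp_tuple[OF Pr.IH(2)[of "Suc (Suc n')"], where G = "\<lambda>i e. if i = 0 then arg e 2 else
            if i = 1 then arg e 0 - 1 else if i = 2 then arg e 1 else arg e (Suc i)"])
        (auto intro!: total_rec_intros simp: Suc nth_Cons' nth_tl arg_def numeral_2_eq_2 numeral_3_eq_3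
          simp del: One_nat_def, rule arg_cong2[where f = nth], rule refl, linarith)
    then show ?thesis by simp
  qed
  have "total_rec (Suc n) (\<lambda>e. if n = 0 then 0
     else rec_nat (clk f (arg e 0) (tl (tl e)))
       (\<lambda>i y. if y = 0 then 0 else clk g (arg e 0) ((y - 1) # i # tl (tl e))) (arg e 1))"
    using g by (intro total_rec_if total_rec_const total_rec_eq total_rec_rec_nat f total_rec_arg)
      (simp add: arg_tl numeral_2_eq_2)
  then show ?case
    by (rule total_rec_cong) (auto simp: arg_tl simp flip: length_0_conv)
next
  case (Mn f)
  have f: "total_rec (Suc (Suc n)) (\<lambda>e. clk f (arg e 1) (arg e 0 # tl (tl e)))"
  proof -
    have "total_rec (Suc (Suc n)) (\<lambda>e. clk f (arg (arg e 1 # arg e 0 # tl (tl e)) 0)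
        (tl (arg e 1 # arg e 0 # tl (tl e))))"
      by (rule total_rec_comp_tuple[OF Mn.IH[of "Suc n"], where G = "\<lambda>i e. if i = 0 then arg e 1 else
            if i = 1 then arg e 0 else arg e i"])
        (auto intro!: total_rec_intros simp: nth_Cons' nth_tl arg_def simp del: One_nat_def,
          rule arg_cong2[where f = nth], rule refl, linarith)
    then show ?thesis by simp
  qed
  have m: "total_rec (Suc n) (\<lambda>e. bleast (\<lambda>m. clk f (arg e 0) (m # tl e) \<le> 1) (arg e 0))"
    using f by (intro total_rec_bleast total_rec_le total_rec_const total_rec_arg) (simp add: arg_tl)
  have "total_rec (Suc n) (\<lambda>e. clk f (arg e 0)
      (bleast (\<lambda>m. clk f (arg e 0) (m # tl e) \<le> 1) (arg e 0) # tl e))"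
    using f by (intro total_rec_hd_tl[OF _ m]) (simp add: arg_tl)
  with m show ?case unfolding clk.simps Let_def
    by (intro total_rec_if total_rec_conj total_rec_eq total_rec_less total_rec_Suc total_rec_arg total_rec_const)
qed

lemma total_rec_clk1:
  assumes "total_rec n a" "total_rec n b"
  shows "total_rec n (\<lambda>e. clk f (a e) [b e])"
proof (rule total_rec_comp2[OF _ assms])
  show "total_rec 2 (\<lambda>e. clk f (arg e 0) [arg e 1])"
    by (rule total_rec_cong[of _ "\<lambda>e. clk f (arg e 0) (tl e)"])
      (auto simp: total_rec_clk[of 1, simplified] numeral_2_eq_2 length_Suc_conv)
qed

lemma total_rec_clk2:
  assumes "total_rec n a" "total_rec n b" "total_rec n c"
  shows "total_rec n (\<lambda>e. clk f (a e) [b e, c e])"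
proof (rule total_rec_comp3[OF _ assms])
  show "total_rec 3 (\<lambda>e. clk f (arg e 0) [arg e 1, arg e 2])"
    by (rule total_rec_cong[of _ "\<lambda>e. clk f (arg e 0) (tl e)"])
      (auto simp: total_rec_clk[of 2, simplified] numeral_2_eq_2 numeral_3_eq_3 length_Suc_conv
        intro: total_rec_clk)
qed

section \<open>Codes of strings\<close>

text \<open>\<open>enc\<close> is bijective binary notation, lowest digit first, so codes are
  ordered by length: strings of length \<open>n\<close> fill the interval from
  \<open>2 ^ n - 1\<close> to \<open>2 ^ Suc n - 2\<close>.\<close>

lemma enc_bounds: "2 ^ length x \<le> Suc (enc x) \<and> Suc (enc x) < 2 ^ Suc (length x)"
  by (induction x) auto

lemma length_le_iff_enc: "length x \<le> n \<longleftrightarrow> enc x < 2 ^ Suc n - 1"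
proof
  assume "length x \<le> n"
  then have "(2::nat) ^ Suc (length x) \<le> 2 ^ Suc n" by (intro power_increasing) auto
  then show "enc x < 2 ^ Suc n - 1" using enc_bounds[of x] by linarith
next
  assume "enc x < 2 ^ Suc n - 1"
  then have "(2::nat) ^ length x < 2 ^ Suc n" using enc_bounds[of x] by linarith
  then have "length x < Suc n" by (rule power_less_imp_less_exp[rotated]) simp
  then show "length x \<le> n" by simp
qed

lemma length_eq_iff_enc: "length x = n \<longleftrightarrow> 2 ^ n - 1 \<le> enc x \<and> enc x < 2 ^ Suc n - 1"
proof (cases n)
  case 0
  then show ?thesis using length_le_iff_enc[of x 0] by simp
next
  case (Suc m)
  then show ?thesis using length_le_iff_enc[of x m] length_le_iff_enc[of x n] by auto
qed

lemma inj_enc: "inj enc"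
proof (rule injI)
  show "x = y" if "enc x = enc y" for x y
    using that
  proof (induction x arbitrary: y)
    case Nil
    then show ?case by (cases y) (auto split: if_splits)
  next
    case (Cons b x)
    then obtain b' y' where y: "y = b' # y'" by (cases y) (auto split: if_splits)
    have "odd (enc (b # x)) \<longleftrightarrow> \<not> b" "odd (enc y) \<longleftrightarrow> \<not> b'" by (auto simp: y)
    with Cons y show ?case by auto
  qed
qed

lemma surj_enc: "\<exists>x. enc x = n"
proof (induction n rule: less_induct)
  case (less n)
  show ?case
  proof (cases "n = 0")
    case False
    obtain m b where n: "n = 2 * m + (if b then 2 else 1)"
    proof (cases "odd n")
      case True
      then show thesis using that[of "n div 2" False] by simp
    next
      case even: False
      then have "n = 2 * (n div 2 - 1) + 2" using False by presburger
      then show thesis using that[of "n div 2 - 1" True] by simp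
    qed
    then have "m < n" by simp
    then obtain x where "enc x = m" using less by blast
    then have "enc (b # x) = n" using n by simp
    then show ?thesis by blast
  qed (auto intro: exI[of _ "[]"])
qed

definition dec :: "nat \<Rightarrow> bool list" where
  "dec = inv enc"

lemma dec_enc [simp]: "dec (enc x) = x"
  by (simp add: dec_def inj_enc)

lemma enc_dec [simp]: "enc (dec n) = n"
  unfolding dec_def using surj_enc f_inv_into_f[of n enc UNIV] by (metis rangeI)

lemma bij_betw_enc_length_le: "bij_betw enc {x. length x \<le> n} {..<2 ^ Suc n - 1}"
  by (rule bij_betwI[of _ _ _ dec]) (auto simp: length_le_iff_enc simp del: power_Suc)

lemma bij_betw_dec_length_eq: "bij_betw (\<lambda>j. dec (2 ^ t - 1 + j)) {..<2 ^ t} {r. length r = t}"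
  by (rule bij_betwI[of _ _ _ "\<lambda>r. enc r - (2 ^ t - 1)"]) (auto simp: length_eq_iff_enc)

section \<open>Optimal machines\<close>

lemma ex_machine_of_recf:
  obtains V where "machine V" "\<And>x y. V x = Some y \<longleftrightarrow> ev f [enc x] (enc y)"
proof -
  let ?V = "\<lambda>x. if \<exists>n. ev f [enc x] n then Some (dec (THE n. ev f [enc x] n)) else None"
  have V: "?V x = Some y \<longleftrightarrow> ev f [enc x] (enc y)" for x y
  proof (cases "\<exists>n. ev f [enc x] n")
    case True
    then obtain n where n: "ev f [enc x] n" by blast
    then have "(THE n. ev f [enc x] n) = n" by (blast intro: ev_fun)
    with n show ?thesis by (auto dest: ev_fun[OF n])
  qed auto
  have "ev f [enc x] n \<longleftrightarrow> (\<exists>y. ?V x = Some y \<and> n = enc y)" for x n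
    unfolding V by (metis enc_dec)
  then have "machine ?V" unfolding machine_def by blast
  with V show thesis using that by blast
qed

lemma Cplx_le_enatD:
  assumes "Cplx U x \<le> enat m"
  obtains p where "U p = Some x" "length p \<le> m"
proof -
  have "\<exists>p. U p = Some x \<and> length p \<le> m"
  proof (rule ccontr)
    assume "\<not> ?thesis"
    then have "enat (Suc m) \<le> Cplx U x"
      unfolding Cplx_def by (intro INF_greatest) (auto simp: not_le)
    with assms show False using order_trans by fastforce
  qed
  then show thesis using that by blast
qed

text \<open>Optimality in terms of codes: \<open>w\<close> is the code of a string of length below \<open>L\<close>
  iff \<open>w + 1 < 2 ^ L\<close>.\<close>

definition universal :: "recf \<Rightarrow> bool" where
  "universal u \<longleftrightarrow> (\<forall>f. \<exists>c. \<forall>L w y. ev f [w] y \<longrightarrow> Suc w < 2 ^ L \<longrightarrow>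
     (\<exists>q. ev u [q] y \<and> Suc q < 2 ^ (L + c)))"

lemma optimal_universal:
  assumes "optimal U" and u: "\<And>x n. ev u [enc x] n \<longleftrightarrow> (\<exists>y. U x = Some y \<and> n = enc y)"
  shows "universal u"
  unfolding universal_def
proof
  fix f
  obtain V where V: "machine V" "\<And>x y. V x = Some y \<longleftrightarrow> ev f [enc x] (enc y)"
    using ex_machine_of_recf by blast
  then obtain c where c: "\<And>x. Cplx U x \<le> Cplx V x + enat c"
    using assms unfolding optimal_def by blast
  have "\<exists>q. ev u [q] y \<and> Suc q < 2 ^ (L + c)" if "ev f [w] y" "Suc w < 2 ^ L" for L w y
  proof -
    have "V (dec w) = Some (dec y)" using V(2) that by simp
    then have "Cplx V (dec y) \<le> enat (length (dec w))"
      unfolding Cplx_def by (intro INF_lower2[of "dec w"]) auto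
    with c have "Cplx U (dec y) \<le> enat (length (dec w) + c)"
      by (metis add_right_mono order_trans plus_enat_simps(1))
    then obtain q where q: "U q = Some (dec y)" "length q \<le> length (dec w) + c"
      by (elim Cplx_le_enatD)
    have "(2::nat) ^ length (dec w) < 2 ^ L" using enc_bounds[of "dec w", unfolded enc_dec] that(2) by linarith
    then have "length (dec w) < L" by (rule power_less_imp_less_exp[rotated]) simp
    then have "(2::nat) ^ Suc (length q) \<le> 2 ^ (L + c)" using q by (intro power_increasing) auto
    then have "Suc (enc q) < 2 ^ (L + c)" using enc_bounds[of q] by linarith
    moreover have "ev u [enc q] y" using u q by auto
    ultimately show ?thesis by blast
  qed
  then show "\<exists>c. \<forall>L w y. ev f [w] y \<longrightarrow> Suc w < 2 ^ L \<longrightarrow> (\<exists>q. ev u [q] y \<and> Suc q < 2 ^ (L + c))"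
    by blast
qed

section \<open>The number of halting programs cannot be approximated\<close>

definition halting :: "recf \<Rightarrow> nat \<Rightarrow> nat set" where
  "halting u n = {i. i < 2 ^ Suc n - 1 \<and> (\<exists>y. ev u [i] y)}"

lemma finite_halting [simp]: "finite (halting u n)"
  unfolding halting_def by simp

definition halted :: "recf \<Rightarrow> nat \<Rightarrow> nat \<Rightarrow> nat" where
  "halted u t n = (\<Sum>i<2 ^ Suc n - 1. of_bool (clk u t [i] \<noteq> 0))"

lemma total_rec_halted:
  assumes "total_rec n a" "total_rec n b"
  shows "total_rec n (\<lambda>e. halted u (a e) (b e))"
  unfolding halted_def
  by (rule total_rec_comp2[where F = "\<lambda>t n. \<Sum>i<2 ^ Suc n - 1. of_bool (clk u t [i] \<noteq> 0)", OF _ assms])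
    (rule total_rec_intros total_rec_clk1 | unfold arg_tl)+

lemma halted_eq_card: "halted u t n = card {i. i < 2 ^ Suc n - 1 \<and> clk u t [i] \<noteq> 0}"
proof -
  have "{i. i < 2 ^ Suc n - 1 \<and> clk u t [i] \<noteq> 0} = {..<2 ^ Suc n - 1} \<inter> {i. clk u t [i] \<noteq> 0}"
    by auto
  then show ?thesis unfolding halted_def by (simp only: sum_of_bool_eq finite_lessThan of_nat_id)
qed

lemma ex_halted_ge: "\<exists>t. \<forall>s\<ge>t. card (halting u n) \<le> halted u s n"
proof -
  have "\<exists>t. \<forall>i<2 ^ Suc n - 1. (\<exists>y. ev u [i] y) \<longrightarrow> clk u t [i] \<noteq> 0"
  proof (intro ex_uniform_bound allI impI)
    show "\<exists>s. (\<exists>y. ev u [i] y) \<longrightarrow> clk u s [i] \<noteq> 0" for i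
      unfolding ev_iff_clk by (metis nat.distinct(1))
    show "clk u s' [i] \<noteq> 0" if "(\<exists>y. ev u [i] y) \<longrightarrow> clk u s [i] \<noteq> 0" "s \<le> s'" "\<exists>y. ev u [i] y"
      for i s s'
      using that clk_mono by metis
  qed
  then obtain t where t: "\<forall>i<2 ^ Suc n - 1. (\<exists>y. ev u [i] y) \<longrightarrow> clk u t [i] \<noteq> 0" by blast
  have "card (halting u n) \<le> halted u s n" if "t \<le> s" for s
    unfolding halted_eq_card halting_def
    using t clk_mono[OF _ that] by (intro card_mono) fastforce+
  then show ?thesis by blast
qed

text \<open>The programs halted by stage \<open>t\<close> form a subset of the halting ones, and the
  cardinalities force equality. Thus the bare number of halting programs tells which ones
  halt.\<close>

lemma clk_nonzero_of_halted_ge: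
  assumes "card (halting u n) \<le> halted u t n" "i \<in> halting u n"
  shows "clk u t [i] \<noteq> 0"
proof -
  have "{i. i < 2 ^ Suc n - 1 \<and> clk u t [i] \<noteq> 0} = halting u n"
  proof (rule card_seteq)
    show "{i. i < 2 ^ Suc n - 1 \<and> clk u t [i] \<noteq> 0} \<subseteq> halting u n"
      unfolding halting_def ev_iff_clk by (auto simp: gr0_conv_Suc simp del: power_Suc)
  qed (use assms in \<open>auto simp: halted_eq_card\<close>)
  with assms(2) show ?thesis by blast
qed

text \<open>By the pigeonhole principle the search succeeds: fewer than \<open>2 ^ Suc n\<close>
  programs cannot produce \<open>2 ^ Suc n\<close> candidates. Once all halting programs of length
  at most \<open>n\<close> have halted, the result is an output of none of them.\<close>

definition nonvalue :: "recf \<Rightarrow> nat \<Rightarrow> nat \<Rightarrow> nat" where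
  "nonvalue u t n = bleast (\<lambda>z. \<forall>i<2 ^ Suc n - 1. clk u t [i] \<noteq> Suc z) (2 ^ Suc n)"

lemma total_rec_nonvalue:
  assumes "total_rec n a" "total_rec n b"
  shows "total_rec n (\<lambda>e. nonvalue u (a e) (b e))"
  unfolding nonvalue_def
  by (rule total_rec_comp2[where
        F = "\<lambda>t n. bleast (\<lambda>z. \<forall>i<2 ^ Suc n - 1. clk u t [i] \<noteq> Suc z) (2 ^ Suc n)", OF _ assms])
    (rule total_rec_intros total_rec_clk1 | unfold arg_tl)+

lemma nonvalue:
  assumes "i < 2 ^ Suc n - 1"
  shows "clk u t [i] \<noteq> Suc (nonvalue u t n)"
proof -
  let ?P = "\<lambda>z. \<forall>i<2 ^ Suc n - 1. clk u t [i] \<noteq> Suc z"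
  have "bleast ?P (2 ^ Suc n) < 2 ^ Suc n"
  proof (rule ccontr)
    assume "\<not> ?thesis"
    then have none: "\<not> ?P z" if "z < 2 ^ Suc n" for z
      using that by (intro bleast_below[of z ?P "2 ^ Suc n"]) linarith
    have "{..<2 ^ Suc n} \<subseteq> (\<lambda>i. clk u t [i] - 1) ` {..<2 ^ Suc n - 1}"
    proof
      fix z :: nat assume "z \<in> {..<2 ^ Suc n}"
      then obtain i where "i < 2 ^ Suc n - 1" "clk u t [i] = Suc z" using none[of z] by blast
      then show "z \<in> (\<lambda>i. clk u t [i] - 1) ` {..<2 ^ Suc n - 1}"
        by (intro image_eqI[of _ _ i]) simp_all
    qed
    from surj_card_le[OF _ this] have "(2::nat) ^ Suc n \<le> 2 ^ Suc n - 1"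
      by (simp only: finite_lessThan card_lessThan)
    moreover have "(0::nat) < 2 ^ Suc n" by simp
    ultimately show False by linarith
  qed
  from bleast_holds[OF this] assms show ?thesis unfolding nonvalue_def by blast
qed

text \<open>A description \<open>w\<close> with \<open>w + 1 = 2 ^ k * (2 * (2 ^ l + v) + 1)\<close> and \<open>v < 2 ^ l\<close> carries
  the triple \<open>(k, l, v)\<close> in \<open>k + l + 1\<close> bits.\<close>

definition level :: "nat \<Rightarrow> nat" where
  "level w = bleast (\<lambda>k. Suc w mod 2 ^ Suc k \<noteq> 0) (Suc w)"

definition bits :: "nat \<Rightarrow> nat" where
  "bits u = bleast (\<lambda>l. u < 2 ^ Suc l) (Suc u)"

definition payload :: "nat \<Rightarrow> nat" where
  "payload w = Suc w div 2 ^ Suc (level w)"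

definition offset :: "nat \<Rightarrow> nat" where
  "offset w = payload w - 2 ^ bits (payload w)"

text \<open>Inverts \<open>l = n - 2 * k + 2\<close>, the number of offset bits in the descriptions
  used below; so \<open>n\<close> is recovered without being stored.\<close>

definition size_of :: "nat \<Rightarrow> nat" where
  "size_of w = bits (payload w) + 2 * level w - 2"

lemma total_rec_bits: "total_rec n a \<Longrightarrow> total_rec n (\<lambda>e. bits (a e))"
  unfolding bits_def
  by (erule total_rec_comp1[where F = "\<lambda>u. bleast (\<lambda>l. u < 2 ^ Suc l) (Suc u)", rotated])
    (rule total_rec_intros | unfold arg_tl)+

lemma total_rec_level: "total_rec n a \<Longrightarrow> total_rec n (\<lambda>e. level (a e))"
  unfolding level_def
  by (erule total_rec_comp1[where F = "\<lambda>w. bleast (\<lambda>k. Suc w mod 2 ^ Suc k \<noteq> 0) (Suc w)", rotated])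
    (rule total_rec_intros total_rec_mod | unfold arg_tl)+

lemma total_rec_payload: "total_rec n a \<Longrightarrow> total_rec n (\<lambda>e. payload (a e))"
  unfolding payload_def by (intro total_rec_intros total_rec_div total_rec_level)

lemma total_rec_offset: "total_rec n a \<Longrightarrow> total_rec n (\<lambda>e. offset (a e))"
  unfolding offset_def by (intro total_rec_intros total_rec_payload total_rec_bits)

lemma total_rec_size_of: "total_rec n a \<Longrightarrow> total_rec n (\<lambda>e. size_of (a e))"
  unfolding size_of_def by (intro total_rec_intros total_rec_payload total_rec_bits total_rec_level)

lemma bits_eq:
  assumes "v < 2 ^ l"
  shows "bits (2 ^ l + v) = l"
  unfolding bits_def
proof (rule bleast_eqI)
  show "2 ^ l + v < 2 ^ Suc l" using assms by simp
  show "l < Suc (2 ^ l + v)" using less_exp[of l] by linarith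
  show "\<not> 2 ^ l + v < 2 ^ Suc i" if "i < l" for i
  proof -
    have "(2::nat) ^ Suc i \<le> 2 ^ l" using that by (intro power_increasing) auto
    then show ?thesis by linarith
  qed
qed

text \<open>In binary \<open>Suc w\<close> ends with a 1 followed by \<open>k\<close> zeros: the
  number of zeros is the level, the digits before that 1 form the payload.\<close>

lemma description_parts:
  assumes w: "Suc w = 2 ^ k * (2 * u + 1)"
  shows "level w = k" "payload w = u"
proof -
  show k: "level w = k"
    unfolding level_def
  proof (rule bleast_eqI)
    have "Suc w = 2 ^ k + 2 ^ Suc k * u" by (simp add: w algebra_simps)
    then have "Suc w mod 2 ^ Suc k = 2 ^ k" by (simp add: mod_less del: power_Suc)
    then show "Suc w mod 2 ^ Suc k \<noteq> 0" by simp
    have "k < 2 ^ k" by (rule less_exp)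
    also have "\<dots> \<le> Suc w" unfolding w by simp
    finally show "k < Suc w" .
    show "\<not> Suc w mod 2 ^ Suc i \<noteq> 0" if "i < k" for i
    proof -
      have "(2::nat) ^ Suc i dvd 2 ^ k" using that by (intro le_imp_power_dvd) simp
      then have "2 ^ Suc i dvd Suc w" unfolding w by (rule dvd_mult2)
      then show ?thesis by simp
    qed
  qed
  have "Suc w = 2 ^ k + u * 2 ^ Suc k" by (simp add: w algebra_simps)
  then have "Suc w div 2 ^ Suc k = u + 2 ^ k div 2 ^ Suc k"
    by (simp only:) (simp del: power_Suc)
  then show "payload w = u" unfolding payload_def k by simp
qed

text \<open>An approximation of the number of halting programs up to \<open>2 ^ (n - 2 * k)\<close> can be
  corrected by an offset of \<open>n - 2 * k + 2\<close> bits. The exact number reveals a string that is not an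
  output of any program of length at most \<open>n\<close>, although it has a description of length
  \<open>n - k + O(1)\<close>.\<close>

lemma no_approximation:
  assumes "universal u"
  obtains c where "\<And>n k a. c \<le> k \<Longrightarrow> 2 * k \<le> n \<Longrightarrow> ev f [n, k] a \<Longrightarrow>
    a \<le> card (halting u n) + 2 ^ (n - 2 * k) \<Longrightarrow>
    card (halting u n) \<le> a + 2 ^ (n - 2 * k) \<Longrightarrow> False"
proof -
  \<comment> \<open>The summand \<open>2 ^ (n - 2 * k)\<close> lets the natural number
    \<open>offset w\<close> encode a signed correction of the approximation.\<close>
  define P where "P t xs \<longleftrightarrow> (let w = arg xs 0; n = size_of w; k = level w in
    clk f t [n, k] \<noteq> 0 \<and> clk f t [n, k] - 1 + offset w \<le> halted u t n + 2 ^ (n - 2 * k))" for t xs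
  have "total_rec (Suc 1) (\<lambda>e. of_bool (P (arg e 0) (tl e)))"
    unfolding P_def Let_def arg_tl
    by (intro total_rec_intros total_rec_clk2 total_rec_size_of total_rec_level total_rec_offset
        total_rec_halted)
  moreover have "total_rec (Suc 1) (\<lambda>e. nonvalue u (arg e 0) (size_of (arg (tl e) 0)))"
    unfolding arg_tl by (intro total_rec_intros total_rec_nonvalue total_rec_size_of)
  ultimately obtain g where g: "\<And>xs y. length xs = 1 \<Longrightarrow> ev g xs y \<longleftrightarrow>
      (\<exists>t. P t xs \<and> (\<forall>s<t. \<not> P s xs) \<and> y = nonvalue u t (size_of (arg xs 0)))"
    by (rule recf_search) blast
  obtain c where c: "\<And>L w y. ev g [w] y \<Longrightarrow> Suc w < 2 ^ L \<Longrightarrow> \<exists>q. ev u [q] y \<and> Suc q < 2 ^ (L + c)"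
    using assms unfolding universal_def by blast
  show thesis
  proof (rule that)
    fix n k a
    \<comment> \<open>This gives \<open>n - k + 4 + c \<le> n + 1\<close>, which places the
      \<open>U\<close>-program for the contradictory value among those of length at most
      \<open>n\<close>.\<close>
    assume k: "c + 3 \<le> k" "2 * k \<le> n" and a: "ev f [n, k] a"
      and le: "a \<le> card (halting u n) + 2 ^ (n - 2 * k)" "card (halting u n) \<le> a + 2 ^ (n - 2 * k)"
    define l where "l = n - 2 * k + 2"
    define v where "v = card (halting u n) + 2 ^ (n - 2 * k) - a"
    have "v \<le> 2 * 2 ^ (n - 2 * k)" using le unfolding v_def by linarith
    also have "\<dots> < 2 ^ l" unfolding l_def by simp
    finally have v: "v < 2 ^ l" .
    define w where "w = 2 ^ k * (2 * (2 ^ l + v) + 1) - 1"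
    have w: "Suc w = 2 ^ k * (2 * (2 ^ l + v) + 1)" unfolding w_def by simp
    note lw = description_parts[OF w]
    have off: "offset w = v" and sz: "size_of w = n"
      using k v by (simp_all add: offset_def size_of_def lw bits_eq) (simp add: l_def)
    have P_eq: "P t [w] \<longleftrightarrow> clk f t [n, k] \<noteq> 0 \<and>
        clk f t [n, k] - 1 + v \<le> halted u t n + 2 ^ (n - 2 * k)" for t
      unfolding P_def Let_def by (simp add: off sz lw)
    obtain t0 where t0: "\<forall>s\<ge>t0. card (halting u n) \<le> halted u s n" using ex_halted_ge by blast
    obtain t1 where t1: "clk f t1 [n, k] = Suc a" using a ev_iff_clk by blast
    have "P (max t0 t1) [w]"
      using t0 clk_Suc_mono[OF t1, of "max t0 t1"] le unfolding P_eq v_def by simp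
    then obtain t where t: "P t [w]" "\<forall>s<t. \<not> P s [w]"
      using exists_least_iff[of "\<lambda>t. P t [w]"] by blast
    have "clk f t [n, k] = Suc a"
      using t(1) a unfolding P_eq by (metis clk_sound ev_fun not0_implies_Suc)
    \<comment> \<open>By the choice of \<open>v\<close> the approximation \<open>a\<close> cancels
      from the condition.\<close>
    then have full: "card (halting u n) \<le> halted u t n"
      using t(1) le unfolding P_eq v_def by simp
    have "ev g [w] (nonvalue u t n)" using t g[of "[w]"] by (auto simp: sz)
    moreover have "Suc w < 2 ^ (n - k + 4)"
    proof -
      have "2 * (2 ^ l + v) + 1 < 2 ^ (l + 2)" using v by simp
      then have "Suc w < 2 ^ k * 2 ^ (l + 2)" unfolding w by (intro mult_strict_left_mono) simp_all
      also have "\<dots> = 2 ^ (n - k + 4)"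
        using k unfolding l_def power_add[symmetric] by (intro arg_cong[where f = "(^) 2"]) simp
      finally show ?thesis .
    qed
    ultimately obtain q where q: "ev u [q] (nonvalue u t n)" "Suc q < 2 ^ (n - k + 4 + c)"
      using c by blast
    have "(2::nat) ^ (n - k + 4 + c) \<le> 2 ^ Suc n" using k by (intro power_increasing) auto
    with q have q': "q < 2 ^ Suc n - 1" by linarith
    then have "clk u t [q] \<noteq> 0"
      using full q by (intro clk_nonzero_of_halted_ge) (auto simp: halting_def)
    then have "clk u t [q] = Suc (nonvalue u t n)"
      using q(1) by (metis clk_sound ev_fun not0_implies_Suc)
    with nonvalue[OF q'] show False by blast
  qed
qed

section \<open>Error frequencies of randomized algorithms\<close>

definition freq :: "(bool list \<Rightarrow> bool list \<Rightarrow> bool list option) \<Rightarrow> bool list \<Rightarrow>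
    (bool list option \<Rightarrow> bool) \<Rightarrow> nat \<Rightarrow> real" where
  "freq A x Q t = real (card {r. length r = t \<and> Q (A x r)}) / 2 ^ t"

lemma finite_length_eq: "finite {r :: bool list. length r = t \<and> P r}"
  using finite_lists_length_eq[of "UNIV :: bool set" t] by simp

lemma card_length_eq: "card {r :: bool list. length r = t} = 2 ^ t"
  using card_lists_length_eq[of "UNIV :: bool set" t] by (simp add: card_UNIV_bool)

lemma finite_length_le: "finite {x :: bool list. length x \<le> n}"
  using finite_lists_length_le[of "UNIV :: bool set" n] by simp

lemma card_length_le: "card {x :: bool list. length x \<le> n} = 2 ^ Suc n - 1"
  using bij_betw_same_card[OF bij_betw_enc_length_le] by simp

lemma freq_nonneg: "0 \<le> freq A x Q t"
  by (simp add: freq_def)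

lemma freq_le_1: "freq A x Q t \<le> 1"
proof -
  have "card {r. length r = t \<and> Q (A x r)} \<le> 2 ^ t"
    unfolding card_length_eq[symmetric] using finite_length_eq[of t "\<lambda>_. True"]
    by (intro card_mono) auto
  then have "real (card {r. length r = t \<and> Q (A x r)}) \<le> 2 ^ t"
    by (metis of_nat_le_iff of_nat_numeral of_nat_power)
  then show ?thesis unfolding freq_def by simp
qed

lemma freq_mono_pred: "(\<And>z. Q z \<Longrightarrow> R z) \<Longrightarrow> freq A x Q t \<le> freq A x R t"
  unfolding freq_def using finite_length_eq[of t "\<lambda>r. R (A x r)"]
  by (intro divide_right_mono of_nat_mono card_mono) auto

lemma freq_disj:
  assumes "\<And>z. Q z \<Longrightarrow> \<not> R z"
  shows "freq A x (\<lambda>z. Q z \<or> R z) t = freq A x Q t + freq A x R t"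
proof -
  have "{r. length r = t \<and> (Q (A x r) \<or> R (A x r))} =
      {r. length r = t \<and> Q (A x r)} \<union> {r. length r = t \<and> R (A x r)}" by auto
  then have "card {r. length r = t \<and> (Q (A x r) \<or> R (A x r))} =
      card {r. length r = t \<and> Q (A x r)} + card {r. length r = t \<and> R (A x r)}"
    using assms by (auto intro!: card_Un_disjoint finite_length_eq)
  then show ?thesis unfolding freq_def by (simp add: add_divide_distrib)
qed

lemma freq_True: "freq A x (\<lambda>_. True) t = 1"
  by (simp add: freq_def card_length_eq)

text \<open>A toss sequence with an answer has two one-toss extensions with the same answer. Silence
  does not persist, hence the assumption on \<open>None\<close>.\<close>

lemma freq_incseq:
  assumes A: "randomized_algorithm A" and Q: "\<not> Q None"
  shows "incseq (freq A x Q)"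
proof (rule incseq_SucI)
  fix t
  let ?S = "\<lambda>t. {r. length r = t \<and> Q (A x r)}"
  let ?f = "\<lambda>(r, b). r @ [b]"
  have "?f ` (?S t \<times> (UNIV :: bool set)) \<subseteq> ?S (Suc t)"
  proof clarsimp
    fix r b assume q: "Q (A x r)"
    then have "A x r \<noteq> None" using Q by metis
    then have "A x (r @ [b]) = A x r"
      using A unfolding randomized_algorithm_def by blast
    with q show "Q (A x (r @ [b]))" by simp
  qed
  moreover have "inj_on ?f (?S t \<times> (UNIV :: bool set))" by (auto simp: inj_on_def)
  ultimately have "card (?S t \<times> (UNIV :: bool set)) \<le> card (?S (Suc t))"
    by (intro card_inj_on_le finite_length_eq)
  then have "card (?S t) * 2 \<le> card (?S (Suc t))" by (simp add: card_cartesian_product card_UNIV_bool)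
  then have "real (card (?S t)) * 2 \<le> real (card (?S (Suc t)))" by linarith
  then show "freq A x Q t \<le> freq A x Q (Suc t)" unfolding freq_def by (simp add: field_simps)
qed

lemma prob_out_eq: "prob_out A x y = (SUP t. freq A x (\<lambda>z. z = Some y) t)"
  by (simp add: prob_out_def freq_def)

lemma bdd_above_freq: "bdd_above (range (freq A x Q))"
  using freq_le_1 by (intro bdd_aboveI[of _ 1]) auto

lemma freq_tendsto_prob_out:
  assumes "randomized_algorithm A"
  shows "freq A x (\<lambda>z. z = Some y) \<longlonglongrightarrow> prob_out A x y"
  unfolding prob_out_eq by (intro LIMSEQ_incseq_SUP bdd_above_freq freq_incseq assms) simp

text \<open>An answer other than \<open>y\<close> given after \<open>t\<close> tosses persists and
  excludes \<open>y\<close> at all later times; the limit over these times gives the bound.\<close>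

lemma freq_other_le:
  assumes A: "randomized_algorithm A"
  shows "freq A x (\<lambda>z. z \<noteq> None \<and> z \<noteq> Some y) t \<le> 1 - prob_out A x y"
proof -
  let ?other = "\<lambda>z. z \<noteq> None \<and> z \<noteq> Some y"
  have "freq A x ?other t + freq A x (\<lambda>z. z = Some y) s \<le> 1" if "t \<le> s" for s
  proof -
    have "freq A x ?other t \<le> freq A x ?other s"
      by (rule incseqD[OF freq_incseq[OF A] that]) simp
    moreover have "freq A x ?other s + freq A x (\<lambda>z. z = Some y) s \<le> 1"
      by (subst freq_disj[symmetric]) (auto intro: freq_le_1)
    ultimately show ?thesis by linarith
  qed
  then have "\<forall>s\<ge>t. freq A x (\<lambda>z. z = Some y) s \<le> 1 - freq A x ?other t" by fastforce
  then have "prob_out A x y \<le> 1 - freq A x ?other t"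
    by (intro LIMSEQ_le_const2[OF freq_tendsto_prob_out[OF A]]) blast
  then show ?thesis by linarith
qed

text \<open>Inside the domain, answer 1 is missed only through silence or another answer; outside
  it, answer 1 is itself an error. Wrong answers already given at time \<open>t\<close> are bounded
  by \<open>err\<close>.\<close>

lemma freq_accept_error:
  assumes A: "randomized_algorithm A"
  shows "\<bar>freq A x (\<lambda>z. z = Some [True]) t - of_bool (x \<in> dom U)\<bar>
    \<le> err U A x + freq A x (\<lambda>z. z = None) t"
proof (cases "x \<in> dom U")
  case True
  let ?other = "\<lambda>z. z \<noteq> None \<and> z \<noteq> Some [True]"
  have "1 = freq A x (\<lambda>z. z = Some [True] \<or> (z = None \<or> ?other z)) t"
    unfolding freq_True[of A x t, symmetric] by (rule arg_cong[where f = "\<lambda>Q. freq A x Q t"]) auto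
  also have "\<dots> = freq A x (\<lambda>z. z = Some [True]) t + freq A x (\<lambda>z. z = None \<or> ?other z) t"
    by (rule freq_disj) auto
  also have "freq A x (\<lambda>z. z = None \<or> ?other z) t = freq A x (\<lambda>z. z = None) t + freq A x ?other t"
    by (rule freq_disj) auto
  finally show ?thesis
    using freq_other_le[OF A, of x "[True]" t] freq_le_1[of A x "\<lambda>z. z = Some [True]" t] True
    unfolding err_def answer_def by auto
next
  case False
  have "freq A x (\<lambda>z. z = Some [True]) t \<le> freq A x (\<lambda>z. z \<noteq> None \<and> z \<noteq> Some [False]) t"
    by (rule freq_mono_pred) auto
  with False show ?thesis
    using freq_other_le[OF A, of x "[False]" t] freq_nonneg[of A x _ t]
    unfolding err_def answer_def by (auto intro: add_increasing2)
qed

text \<open>Outcomes are numbered as in the definition of a randomized algorithm: 0 stands for no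
  answer yet and 3 for the answer \<open>[True]\<close>.\<close>

definition outcome :: "(bool list \<Rightarrow> bool list \<Rightarrow> bool list option) \<Rightarrow> nat \<Rightarrow> nat \<Rightarrow> nat" where
  "outcome A i j = (case A (dec i) (dec j) of None \<Rightarrow> 0 | Some y \<Rightarrow> Suc (enc y))"

text \<open>Integer counts keep the computation within \<open>recf\<close>; dividing by
  \<open>2 ^ t\<close> yields sums of frequencies. The toss sequences of length \<open>t\<close>
  have the codes \<open>2 ^ t - 1 + j\<close>.\<close>

definition tally :: "(bool list \<Rightarrow> bool list \<Rightarrow> bool list option) \<Rightarrow> nat \<Rightarrow> nat \<Rightarrow> nat \<Rightarrow> nat" where
  "tally A c t n = (\<Sum>i<2 ^ Suc n - 1. \<Sum>j<2 ^ t. of_bool (outcome A i (2 ^ t - 1 + j) = c))"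

lemma total_rec_outcome:
  assumes A: "randomized_algorithm A" and "total_rec n a" "total_rec n b"
  shows "total_rec n (\<lambda>e. outcome A (a e) (b e))"
proof (rule total_rec_comp2[OF _ assms(2,3)])
  from A obtain f where f: "\<And>x r n. ev f [enc x, enc r] n \<longleftrightarrow>
      n = (case A x r of None \<Rightarrow> 0 | Some y \<Rightarrow> Suc (enc y))"
    unfolding randomized_algorithm_def by blast
  have "ev f [i, j] n \<longleftrightarrow> n = outcome A i j" for i j n
    using f[of "dec i" "dec j" n] by (simp add: outcome_def)
  then have "ev f xs n \<longleftrightarrow> n = outcome A (arg xs 0) (arg xs 1)" if "length xs = 2" for xs n
    using that by (auto simp: numeral_2_eq_2 length_Suc_conv)
  then show "total_rec 2 (\<lambda>e. outcome A (arg e 0) (arg e 1))"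
    unfolding total_rec_def by blast
qed

lemma total_rec_tally:
  assumes A: "randomized_algorithm A" and "total_rec n a" "total_rec n b"
  shows "total_rec n (\<lambda>e. tally A c (a e) (b e))"
  unfolding tally_def
  by (rule total_rec_comp2[where F = "\<lambda>t n. \<Sum>i<2 ^ Suc n - 1. \<Sum>j<2 ^ t.
        of_bool (outcome A i (2 ^ t - 1 + j) = c)", OF _ assms(2,3)])
    (rule total_rec_intros total_rec_outcome[OF A] | unfold arg_tl)+

lemma tally_eq_sum_freq:
  "real (tally A c t n) = 2 ^ t * (\<Sum>x | length x \<le> n.
    freq A x (\<lambda>z. (case z of None \<Rightarrow> 0 | Some y \<Rightarrow> Suc (enc y)) = c) t)"
proof -
  let ?g = "\<lambda>z. (case z of None \<Rightarrow> 0 | Some y \<Rightarrow> Suc (enc y))"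
  have inner: "(\<Sum>j<2 ^ t. of_bool (outcome A (enc x) (2 ^ t - 1 + j) = c)) =
      card {r. length r = t \<and> ?g (A x r) = c}" for x
  proof -
    have "(\<Sum>j<2 ^ t. of_bool (outcome A (enc x) (2 ^ t - 1 + j) = c)) =
        (\<Sum>j<2 ^ t. of_bool (?g (A x (dec (2 ^ t - 1 + j))) = c))"
      by (simp add: outcome_def)
    also have "\<dots> = (\<Sum>r | length r = t. of_bool (?g (A x r) = c))"
      by (rule sum.reindex_bij_betw[OF bij_betw_dec_length_eq])
    also have "\<dots> = card ({r. length r = t} \<inter> {r. ?g (A x r) = c})"
      using finite_length_eq[of t "\<lambda>_. True"] by (simp add: sum_of_bool_eq)
    also have "{r. length r = t} \<inter> {r. ?g (A x r) = c} = {r. length r = t \<and> ?g (A x r) = c}" by auto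
    finally show ?thesis .
  qed
  have "tally A c t n = (\<Sum>x | length x \<le> n. \<Sum>j<2 ^ t. of_bool (outcome A (enc x) (2 ^ t - 1 + j) = c))"
    unfolding tally_def by (rule sum.reindex_bij_betw[OF bij_betw_enc_length_le, symmetric])
  then have "tally A c t n = (\<Sum>x | length x \<le> n. card {r. length r = t \<and> ?g (A x r) = c})"
    by (simp only: inner)
  then show ?thesis unfolding freq_def by (simp add: sum_distrib_left)
qed

lemma tally_no_answer:
  "real (tally A 0 t n) = 2 ^ t * (\<Sum>x | length x \<le> n. freq A x (\<lambda>z. z = None) t)"
proof -
  have "(\<lambda>z. (case z of None \<Rightarrow> 0 | Some y \<Rightarrow> Suc (enc y)) = 0) = (\<lambda>z. z = None)"
    by (auto split: option.splits)
  then show ?thesis by (simp add: tally_eq_sum_freq)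
qed

lemma tally_accept:
  "real (tally A 3 t n) = 2 ^ t * (\<Sum>x | length x \<le> n. freq A x (\<lambda>z. z = Some [True]) t)"
proof -
  have "enc [True] = 2" by simp
  then have "enc y = 2 \<longleftrightarrow> y = [True]" for y using inj_enc[THEN injD, of y "[True]"] by auto
  then have "(\<lambda>z. (case z of None \<Rightarrow> 0 | Some y \<Rightarrow> Suc (enc y)) = 3) = (\<lambda>z. z = Some [True])"
    by (auto split: option.splits)
  then show ?thesis by (simp add: tally_eq_sum_freq)
qed

lemma card_halting_eq:
  assumes u: "\<And>x n. ev u [enc x] n \<longleftrightarrow> (\<exists>y. U x = Some y \<and> n = enc y)"
  shows "real (card (halting u n)) = (\<Sum>x | length x \<le> n. of_bool (x \<in> dom U))"
proof -
  have "card (halting u n) = card {x. length x \<le> n \<and> x \<in> dom U}"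
  proof (rule bij_betw_same_card, rule bij_betwI)
    show "enc \<in> {x. length x \<le> n \<and> x \<in> dom U} \<rightarrow> halting u n"
      using u by (auto simp: halting_def length_le_iff_enc simp del: power_Suc)
    show "dec \<in> halting u n \<rightarrow> {x. length x \<le> n \<and> x \<in> dom U}"
      using u[of "dec _"] by (auto simp: halting_def length_le_iff_enc simp del: power_Suc)
  qed auto
  moreover have "{x. length x \<le> n \<and> x \<in> dom U} = {x. length x \<le> n} \<inter> {x. x \<in> dom U}" by auto
  ultimately show ?thesis by (simp only: sum_of_bool_eq finite_length_le)
qed

lemma sum_err_less:
  assumes "eps U A n < 1 / 2 ^ (2 * k + 4)"
  shows "(\<Sum>x | length x \<le> n. err U A x) < 2 ^ n / 2 ^ (2 * k + 3)"
proof -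
  have N: "real (card {x :: bool list. length x \<le> n}) = 2 ^ Suc n - 1"
    by (simp add: card_length_le of_nat_diff)
  have "(1::real) < 2 ^ Suc n" by (rule one_less_power) auto
  then have pos: "(0::real) < 2 ^ Suc n - 1" by simp
  then have "(\<Sum>x | length x \<le> n. err U A x) < 1 / 2 ^ (2 * k + 4) * (2 ^ Suc n - 1)"
    using assms unfolding eps_def N by (simp only: pos_divide_less_eq)
  also have "\<dots> \<le> 1 / 2 ^ (2 * k + 4) * 2 ^ Suc n" by (intro mult_left_mono) auto
  also have "\<dots> = 2 ^ n / 2 ^ (2 * k + 3)" by (simp add: field_simps power_add)
  finally show ?thesis .
qed

text \<open>Silence is at most one minus the frequency of the correct answer, which tends to the
  error, strictly below the bound. The resulting test mentions neither \<open>U\<close> nor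
  correctness, so a program can wait for it.\<close>

lemma eventually_tally_no_answer:
  assumes A: "randomized_algorithm A" and eps: "eps U A n < 1 / 2 ^ (2 * k + 4)"
  shows "eventually (\<lambda>t. 2 ^ (2 * k + 3) * tally A 0 t n \<le> 2 ^ t * 2 ^ n) sequentially"
proof -
  have "(\<lambda>t. \<Sum>x | length x \<le> n. 1 - freq A x (\<lambda>z. z = Some (answer U x)) t) \<longlonglongrightarrow>
      (\<Sum>x | length x \<le> n. err U A x)"
    unfolding err_def by (intro tendsto_sum tendsto_diff tendsto_const freq_tendsto_prob_out A)
  from order_tendstoD(2)[OF this sum_err_less[OF eps]]
  show ?thesis
  proof (rule eventually_mono)
    fix t
    assume less: "(\<Sum>x | length x \<le> n. 1 - freq A x (\<lambda>z. z = Some (answer U x)) t) <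
      2 ^ n / 2 ^ (2 * k + 3)"
    have "freq A x (\<lambda>z. z = None) t \<le> 1 - freq A x (\<lambda>z. z = Some y) t" for x y
    proof -
      have "freq A x (\<lambda>z. z = None) t + freq A x (\<lambda>z. z = Some y) t \<le> 1"
        by (subst freq_disj[symmetric]) (auto intro: freq_le_1)
      then show ?thesis by linarith
    qed
    then have "(\<Sum>x | length x \<le> n. freq A x (\<lambda>z. z = None) t) \<le>
        (\<Sum>x | length x \<le> n. 1 - freq A x (\<lambda>z. z = Some (answer U x)) t)"
      by (intro sum_mono)
    with less have "(\<Sum>x | length x \<le> n. freq A x (\<lambda>z. z = None) t) \<le> 2 ^ n / 2 ^ (2 * k + 3)"
      by linarith
    then have "2 ^ (2 * k + 3) * (\<Sum>x | length x \<le> n. freq A x (\<lambda>z. z = None) t) \<le> 2 ^ n"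
      by (simp add: field_simps)
    then have "2 ^ t * (2 ^ (2 * k + 3) * (\<Sum>x | length x \<le> n. freq A x (\<lambda>z. z = None) t)) \<le> 2 ^ t * 2 ^ n"
      by (intro mult_left_mono) auto
    then have "2 ^ (2 * k + 3) * real (tally A 0 t n) \<le> 2 ^ t * 2 ^ n"
      unfolding tally_no_answer by (simp add: mult_ac)
    then have "real (2 ^ (2 * k + 3) * tally A 0 t n) \<le> real (2 ^ t * 2 ^ n)" by simp
    then show "2 ^ (2 * k + 3) * tally A 0 t n \<le> 2 ^ t * 2 ^ n" by (simp only: of_nat_le_iff)
  qed
qed

text \<open>With \<open>D = 2 ^ (n - 2 * k - 2)\<close>, error and silence contribute at most
  \<open>D / 2\<close> each, and rounding down costs at most 1, hence at most \<open>D\<close>. The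
  total \<open>2 * D\<close> is half the tolerance of \<open>no_approximation\<close>; the other
  half pays for the coarser rounding in the uniform bound.\<close>

lemma tally_accept_approx:
  assumes A: "randomized_algorithm A"
    and u: "\<And>x n. ev u [enc x] n \<longleftrightarrow> (\<exists>y. U x = Some y \<and> n = enc y)"
    and eps: "eps U A n < 1 / 2 ^ (2 * k + 4)" and n: "2 * k + 2 \<le> n"
    and t: "2 ^ (2 * k + 3) * tally A 0 t n \<le> 2 ^ t * 2 ^ n"
  shows "tally A 3 t n div 2 ^ t \<le> card (halting u n) + 2 ^ (n - 2 * k - 1)"
    and "card (halting u n) \<le> tally A 3 t n div 2 ^ t + 2 ^ (n - 2 * k - 1)"
proof -
  define D :: nat where "D = 2 ^ (n - 2 * k - 2)"
  have D1: "1 \<le> D" and D2: "2 ^ (n - 2 * k - 1) = 2 * D"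
    using n by (simp_all add: D_def Suc_diff_Suc flip: power_Suc)
  have "2 ^ n = D * 2 ^ (2 * k + 2)"
    unfolding D_def power_add[symmetric] using n by (intro arg_cong[where f = "(^) 2"]) simp
  then have nD: "(2::real) ^ n = D * 2 ^ (2 * k + 2)"
    by (metis of_nat_mult of_nat_numeral of_nat_power)
  define H where "H = real (card (halting u n))"
  define s where "s = real (tally A 3 t n) / 2 ^ t"
  have "2 ^ t * (2 ^ (2 * k + 3) * (\<Sum>x | length x \<le> n. freq A x (\<lambda>z. z = None) t)) \<le> 2 ^ t * 2 ^ n"
    using t[folded of_nat_le_iff[where ?'a = real]] by (simp add: tally_no_answer mult_ac)
  then have none: "(\<Sum>x | length x \<le> n. freq A x (\<lambda>z. z = None) t) \<le> 2 ^ n / 2 ^ (2 * k + 3)"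
    by (simp add: field_simps)
  have "\<bar>s - H\<bar> = \<bar>\<Sum>x | length x \<le> n. freq A x (\<lambda>z. z = Some [True]) t - of_bool (x \<in> dom U)\<bar>"
    unfolding s_def H_def by (simp add: tally_accept card_halting_eq[OF u] sum_subtractf)
  also have "\<dots> \<le> (\<Sum>x | length x \<le> n. \<bar>freq A x (\<lambda>z. z = Some [True]) t - of_bool (x \<in> dom U)\<bar>)"
    by (rule sum_abs)
  also have "\<dots> \<le> (\<Sum>x | length x \<le> n. err U A x + freq A x (\<lambda>z. z = None) t)"
    by (intro sum_mono freq_accept_error A)
  also have "\<dots> \<le> 2 ^ n / 2 ^ (2 * k + 3) + 2 ^ n / 2 ^ (2 * k + 3)"
    unfolding sum.distrib using sum_err_less[OF eps] none by linarith
  also have "\<dots> = D" unfolding nD by (simp add: power_add)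
  finally have sH: "\<bar>s - H\<bar> \<le> D" .
  define a where "a = tally A 3 t n div 2 ^ t"
  have "real (tally A 3 t n) = a * 2 ^ t + real (tally A 3 t n mod 2 ^ t)"
    unfolding a_def by (metis div_mult_mod_eq of_nat_add of_nat_mult of_nat_numeral of_nat_power)
  moreover have "real (tally A 3 t n mod 2 ^ t) < 2 ^ t"
    by (metis mod_less_divisor of_nat_less_iff of_nat_numeral of_nat_power zero_less_numeral zero_less_power)
  ultimately have "a \<le> s" "s < a + 1" unfolding s_def by (simp_all add: field_simps)
  with sH have "real a \<le> H + D" "H \<le> real a + 1 + D" by linarith+
  then have "a \<le> card (halting u n) + D" "card (halting u n) \<le> a + 1 + D" unfolding H_def by linarith+
  then show "tally A 3 t n div 2 ^ t \<le> card (halting u n) + 2 ^ (n - 2 * k - 1)"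
    "card (halting u n) \<le> tally A 3 t n div 2 ^ t + 2 ^ (n - 2 * k - 1)"
    using D1 unfolding D2 a_def[symmetric] by linarith+
qed

section \<open>Lower bounds for the error\<close>

text \<open>A table of values below \<open>B\<close> is stored as one number in base
  \<open>B\<close>; this reads entry \<open>r\<close> back.\<close>

lemma digit_of_sum:
  fixes d :: "nat \<Rightarrow> nat"
  assumes "\<And>i. i < M \<Longrightarrow> d i < B" "r < M"
  shows "(\<Sum>i<M. B ^ i * d i) div B ^ r mod B = d r"
  using assms
proof (induction M arbitrary: d r)
  case (Suc M)
  let ?S = "\<Sum>i<M. B ^ i * d (Suc i)"
  have S: "(\<Sum>i<Suc M. B ^ i * d i) = d 0 + B * ?S"
    by (simp add: sum.lessThan_Suc_shift sum_distrib_left mult.assoc del: sum.lessThan_Suc)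
  have d0: "d 0 < B" using Suc.prems by simp
  show ?case
  proof (cases r)
    case 0
    then show ?thesis unfolding S using d0 by simp
  next
    case (Suc r')
    have "(d 0 + B * ?S) div B ^ Suc r' = ?S div B ^ r'"
      using d0 by (simp add: div_mult2_eq)
    then show ?thesis
      unfolding S Suc using Suc.IH[of "\<lambda>i. d (Suc i)" r'] Suc.prems \<open>r = Suc r'\<close> by simp
  qed
qed simp

text \<open>A single \<open>n\<close> with smaller error already contradicts
  \<open>no_approximation\<close>, so the bound holds at all large lengths, as the lower limit
  demands. The waiting program runs \<open>A\<close>, so \<open>k\<close> depends on
  \<open>A\<close>.\<close>

lemma eps_lower_bound:
  assumes A: "randomized_algorithm A" and "universal u"
    and u: "\<And>x n. ev u [enc x] n \<longleftrightarrow> (\<exists>y. U x = Some y \<and> n = enc y)"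
  obtains k where "\<And>n. 2 * k + 2 \<le> n \<Longrightarrow> 1 / 2 ^ (2 * k + 4) \<le> eps U A n"
proof -
  define P where "P t xs \<longleftrightarrow>
    2 ^ (2 * arg xs 1 + 3) * tally A 0 t (arg xs 0) \<le> 2 ^ t * 2 ^ arg xs 0" for t xs
  have "total_rec (Suc 2) (\<lambda>e. of_bool (P (arg e 0) (tl e)))"
    unfolding P_def arg_tl by (intro total_rec_intros total_rec_tally A)
  moreover have "total_rec (Suc 2) (\<lambda>e. tally A 3 (arg e 0) (arg (tl e) 0) div 2 ^ arg e 0)"
    unfolding arg_tl by (intro total_rec_intros total_rec_div total_rec_tally A)
  ultimately obtain f where f: "\<And>xs y. length xs = 2 \<Longrightarrow> ev f xs y \<longleftrightarrow>
      (\<exists>t. P t xs \<and> (\<forall>s<t. \<not> P s xs) \<and> y = tally A 3 t (arg xs 0) div 2 ^ t)"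
    by (rule recf_search) blast
  obtain k where k: "\<And>n a. 2 * k \<le> n \<Longrightarrow> ev f [n, k] a \<Longrightarrow>
    a \<le> card (halting u n) + 2 ^ (n - 2 * k) \<Longrightarrow>
    card (halting u n) \<le> a + 2 ^ (n - 2 * k) \<Longrightarrow> False"
    using no_approximation[OF \<open>universal u\<close>, of f] by (metis order_refl)
  show thesis
  proof (rule that, rule ccontr)
    fix n assume n: "2 * k + 2 \<le> n" and "\<not> 1 / 2 ^ (2 * k + 4) \<le> eps U A n"
    then have eps: "eps U A n < 1 / 2 ^ (2 * k + 4)" by simp
    have "\<exists>t. P t [n, k]"
      using eventually_tally_no_answer[OF A eps]
      by (auto simp: P_def eventually_sequentially simp del: power_Suc)
    then obtain t where t: "P t [n, k]" "\<forall>s<t. \<not> P s [n, k]"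
      using exists_least_iff[of "\<lambda>t. P t [n, k]"] by blast
    then have "ev f [n, k] (tally A 3 t n div 2 ^ t)"
      using f[of "[n, k]"] by auto
    moreover have "2 ^ (2 * k + 3) * tally A 0 t n \<le> 2 ^ t * 2 ^ n"
      using t(1) by (simp add: P_def)
    note tally_accept_approx[OF A u eps n this]
    moreover have "(2::nat) ^ (n - 2 * k - 1) \<le> 2 ^ (n - 2 * k)" by (intro power_increasing) auto
    ultimately show False using n by (intro k[of n "tally A 3 t n div 2 ^ t"]) linarith+
  qed
qed

text \<open>Rounding an approximate count for length \<open>n\<close> leaves one digit in base \<open>2 ^ (2 * k + 3)\<close>.
  The digits for all \<open>n\<close> between \<open>2 ^ m\<close> and \<open>2 ^ (m + 1)\<close> form a number computable from
  \<open>m\<close>, hence have a description \<open>q\<close> for \<open>U\<close> with \<open>q < 2 ^ m\<close> when \<open>m\<close> is large. The length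
  \<open>n = 2 ^ m + q\<close> then supplies the description of its own approximation for free. So the algorithm
  approximating the count is independent of \<open>A\<close>, which makes the error bound uniform.\<close>

lemma limsup_eps_lower_bound:
  assumes "universal u"
    and u: "\<And>x n. ev u [enc x] n \<longleftrightarrow> (\<exists>y. U x = Some y \<and> n = enc y)"
  obtains k where "\<And>A. randomized_algorithm A \<Longrightarrow>
    \<not> eventually (\<lambda>n. eps U A n < 1 / 2 ^ (2 * k + 4)) sequentially"
proof -
  \<comment> \<open>Deletes the leading binary digit: a length \<open>2 ^ m + q\<close> with
    \<open>q < 2 ^ m\<close> yields \<open>q\<close>.\<close>
  define idx where "idx n = n - 2 ^ bits n" for n :: nat
  define P where "P t xs \<longleftrightarrow> clk u t [idx (arg xs 0)] \<noteq> 0" for t xs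
  \<comment> \<open>The number \<open>idx n\<close> serves twice: as the program that prints the
    table and as the position in it of the entry for \<open>n\<close>.\<close>
  define out where "out t n k = (clk u t [idx n] - 1) div (2 ^ (2 * k + 3)) ^ idx n
      mod 2 ^ (2 * k + 3) * 2 ^ (n - 2 * k - 1)" for t n k
  have "total_rec (Suc 2) (\<lambda>e. of_bool (P (arg e 0) (tl e)))"
    unfolding P_def idx_def arg_tl by (intro total_rec_intros total_rec_clk1 total_rec_bits)
  moreover have "total_rec (Suc 2) (\<lambda>e. out (arg e 0) (arg (tl e) 0) (arg (tl e) 1))"
    unfolding out_def idx_def arg_tl
    by (intro total_rec_intros total_rec_div total_rec_mod total_rec_clk1 total_rec_bits)
  ultimately obtain f where f: "\<And>xs y. length xs = 2 \<Longrightarrow> ev f xs y \<longleftrightarrow>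
      (\<exists>t. P t xs \<and> (\<forall>s<t. \<not> P s xs) \<and> y = out t (arg xs 0) (arg xs 1))"
    by (rule recf_search) blast
  obtain k where k: "\<And>n a. 2 * k \<le> n \<Longrightarrow> ev f [n, k] a \<Longrightarrow>
    a \<le> card (halting u n) + 2 ^ (n - 2 * k) \<Longrightarrow>
    card (halting u n) \<le> a + 2 ^ (n - 2 * k) \<Longrightarrow> False"
    using no_approximation[OF \<open>universal u\<close>, of f] by (metis order_refl)
  show thesis
  proof (rule that, rule notI)
    fix A assume A: "randomized_algorithm A"
      and ev_eps: "eventually (\<lambda>n. eps U A n < 1 / 2 ^ (2 * k + 4)) sequentially"
    then obtain n0 where n0: "\<And>n. n0 \<le> n \<Longrightarrow> eps U A n < 1 / 2 ^ (2 * k + 4)"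
      unfolding eventually_sequentially by blast
    \<comment> \<open>One digit suffices: a count below \<open>2 ^ (n + 2)\<close> is divided by
      \<open>2 ^ (n - 2 * k - 1)\<close>. The same power is the factor in the test for
      silence.\<close>
    define B :: nat where "B = 2 ^ (2 * k + 3)"
    define Q where "Q t xs \<longleftrightarrow> (\<forall>r<2 ^ arg xs 0.
      B * tally A 0 t (2 ^ arg xs 0 + r) \<le> 2 ^ t * 2 ^ (2 ^ arg xs 0 + r))" for t xs
    define d where "d t n = tally A 3 t n div 2 ^ t div 2 ^ (n - 2 * k - 1)" for t n
    have "total_rec (Suc 1) (\<lambda>e. of_bool (Q (arg e 0) (tl e)))"
      unfolding Q_def by (rule total_rec_intros total_rec_tally A | unfold arg_tl)+
    moreover have "total_rec (Suc 1)
        (\<lambda>e. \<Sum>r<2 ^ arg (tl e) 0. B ^ r * d (arg e 0) (2 ^ arg (tl e) 0 + r))"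
      unfolding d_def by (rule total_rec_intros total_rec_div total_rec_tally A | unfold arg_tl)+
    ultimately obtain g where g: "\<And>xs y. length xs = 1 \<Longrightarrow> ev g xs y \<longleftrightarrow>
        (\<exists>t. Q t xs \<and> (\<forall>s<t. \<not> Q s xs) \<and> y = (\<Sum>r<2 ^ arg xs 0. B ^ r * d t (2 ^ arg xs 0 + r)))"
      by (rule recf_search) blast
    obtain c where c: "\<And>L w y. ev g [w] y \<Longrightarrow> Suc w < 2 ^ L \<Longrightarrow> \<exists>q. ev u [q] y \<and> Suc q < 2 ^ (L + c)"
      using \<open>universal u\<close> unfolding universal_def by blast
    \<comment> \<open>\<open>m\<close> has a code of fewer than \<open>j + 2\<close> bits, which
      leaves at most \<open>j + 2 + c\<close> bits for \<open>q\<close>; as \<open>m\<close> is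
      exponential in \<open>j\<close>, this is at most \<open>m\<close>.\<close>
    define j where "j = c + n0 + 2 * k + 2"
    define m :: nat where "m = 2 ^ (j + 2) - 2"
    have "j < 2 ^ j" by (rule less_exp)
    then have m: "j + 2 + c \<le> m" "n0 \<le> m" "2 * k + 2 \<le> m" "Suc m < 2 ^ (j + 2)"
      unfolding m_def j_def by (simp_all add: power_add)
    have large: "n0 \<le> 2 ^ m + r" "2 * k + 2 \<le> 2 ^ m + r" for r
      using m less_exp[of m] by linarith+
    \<comment> \<open>Only finitely many lengths are involved, so one time \<open>t\<close> serves
      them all.\<close>
    have "eventually (\<lambda>t. \<forall>r\<in>{..<2 ^ m}. B * tally A 0 t (2 ^ m + r) \<le> 2 ^ t * 2 ^ (2 ^ m + r)) sequentially"
      unfolding B_def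
      by (intro eventually_ball_finite ballI finite_lessThan
          eventually_tally_no_answer[where U = U] A n0 large)
    then have "\<exists>t. Q t [m]" unfolding Q_def eventually_sequentially by auto
    then obtain t where t: "Q t [m]" "\<forall>s<t. \<not> Q s [m]"
      using exists_least_iff[of "\<lambda>t. Q t [m]"] by blast
    define T where "T = (\<Sum>r<2 ^ m. B ^ r * d t (2 ^ m + r))"
    have "ev g [m] T" using t g[of "[m]"] unfolding T_def by auto
    then obtain q where q: "ev u [q] T" "Suc q < 2 ^ (j + 2 + c)" using c m by blast
    have "(2::nat) ^ (j + 2 + c) \<le> 2 ^ m" using m by (intro power_increasing) auto
    with q have qm: "q < 2 ^ m" by linarith
    have approx: "tally A 3 t n div 2 ^ t \<le> card (halting u n) + 2 ^ (n - 2 * k - 1)"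
        "card (halting u n) \<le> tally A 3 t n div 2 ^ t + 2 ^ (n - 2 * k - 1)"
      if "r < 2 ^ m" "n = 2 ^ m + r" for n r
      using tally_accept_approx[OF A u, of n k t] n0 large[of r] t(1) that
      by (auto simp: Q_def B_def)
    have digit: "d t (2 ^ m + r) < B" if r: "r < 2 ^ m" for r
    proof -
      let ?n = "2 ^ m + r"
      have "card (halting u ?n) \<le> card {..<2 ^ Suc ?n - 1 :: nat}"
        unfolding halting_def by (intro card_mono) auto
      moreover have "(0::nat) < 2 ^ Suc ?n" by simp
      moreover have "(2::nat) ^ (?n - 2 * k - 1) \<le> 2 ^ Suc ?n" by (intro power_increasing) auto
      ultimately have "tally A 3 t ?n div 2 ^ t < 2 ^ Suc ?n + 2 ^ Suc ?n"
        using approx(1)[OF r refl] unfolding card_lessThan by linarith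
      also have "\<dots> = 2 ^ Suc (Suc ?n)" by simp
      also have "\<dots> = B * 2 ^ (?n - 2 * k - 1)"
        unfolding B_def power_add[symmetric] using large(2)[of r]
        by (intro arg_cong[where f = "(^) 2"]) linarith
      finally show ?thesis unfolding d_def by (rule less_mult_imp_div_less)
    qed
    define n where "n = 2 ^ m + q"
    have idx: "idx n = q" unfolding idx_def n_def bits_eq[OF qm] by simp
    obtain s0 where "clk u s0 [q] = Suc T" using q ev_iff_clk by blast
    then have "\<exists>s. P s [n, k]" unfolding P_def by (intro exI[of _ s0]) (simp add: idx)
    then obtain s where s: "P s [n, k]" "\<forall>s'<s. \<not> P s' [n, k]"
      using exists_least_iff[of "\<lambda>s. P s [n, k]"] by blast
    have "clk u s [q] = Suc T"
      using s(1) q(1) unfolding P_def by (simp add: idx) (metis clk_sound ev_fun gr0_conv_Suc)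
    moreover have "T div B ^ q mod B = d t n"
      unfolding T_def n_def by (rule digit_of_sum[OF digit qm])
    ultimately have "out s n k = d t n * 2 ^ (n - 2 * k - 1)"
      unfolding out_def idx B_def by simp
    then have "ev f [n, k] (d t n * 2 ^ (n - 2 * k - 1))" using s f[of "[n, k]"] by auto
    moreover
    define D :: nat where "D = 2 ^ (n - 2 * k - 1)"
    define a where "a = tally A 3 t n div 2 ^ t"
    \<comment> \<open>Rounding down to a multiple of \<open>D\<close> loses less than
      \<open>D\<close> and the count is off by at most \<open>D\<close>, which together stays within
      the tolerance.\<close>
    have D: "2 ^ (n - 2 * k) = 2 * D"
      using large(2)[of q] unfolding D_def n_def[symmetric] by (simp add: Suc_diff_Suc flip: power_Suc)
    have "d t n = a div D" unfolding d_def D_def a_def ..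
    then have "a = d t n * D + a mod D" by simp
    moreover have "a mod D < D" by (simp add: D_def)
    moreover have "a \<le> card (halting u n) + D" "card (halting u n) \<le> a + D"
      using approx[OF qm n_def] unfolding a_def D_def .
    moreover have "2 * k \<le> n" using large(2)[of q] unfolding n_def by linarith
    ultimately show False
      by (intro k[of n "d t n * D"]) (unfold D D_def[symmetric], linarith+)
  qed
qed

theorem theorem3p3:
  fixes U :: "bool list \<Rightarrow> bool list option"
  assumes "optimal U"
  shows "(\<forall>A. randomized_algorithm A \<longrightarrow> Liminf sequentially (\<lambda>n. ereal (eps U A n)) > 0)
       \<and> (\<exists>e::real. e > 0 \<and> (\<forall>A. randomized_algorithm A \<longrightarrow>
              Limsup sequentially (\<lambda>n. ereal (eps U A n)) \<ge> ereal e))"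
proof -
  obtain u where u: "\<And>x n. ev u [enc x] n \<longleftrightarrow> (\<exists>y. U x = Some y \<and> n = enc y)"
    using assms unfolding optimal_def machine_def by blast
  have univ: "universal u" by (rule optimal_universal[OF assms u])
  show ?thesis
  proof (intro conjI allI impI)
    fix A assume A: "randomized_algorithm A"
    obtain k where k: "\<And>n. 2 * k + 2 \<le> n \<Longrightarrow> 1 / 2 ^ (2 * k + 4) \<le> eps U A n"
      using eps_lower_bound[OF A univ u] by blast
    have "eventually (\<lambda>n. ereal (1 / 2 ^ (2 * k + 4)) \<le> ereal (eps U A n)) sequentially"
      unfolding eventually_sequentially ereal_less_eq using k by blast
    then have "ereal (1 / 2 ^ (2 * k + 4)) \<le> Liminf sequentially (\<lambda>n. ereal (eps U A n))"
      by (rule Liminf_bounded)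
    moreover have "0 < ereal (1 / 2 ^ (2 * k + 4))" by simp
    ultimately show "0 < Liminf sequentially (\<lambda>n. ereal (eps U A n))" by (rule less_le_trans[rotated])
  next
    obtain k where k: "\<And>A. randomized_algorithm A \<Longrightarrow>
        \<not> eventually (\<lambda>n. eps U A n < 1 / 2 ^ (2 * k + 4)) sequentially"
      using limsup_eps_lower_bound[OF univ u] by blast
    show "\<exists>e::real. e > 0 \<and> (\<forall>A. randomized_algorithm A \<longrightarrow>
        Limsup sequentially (\<lambda>n. ereal (eps U A n)) \<ge> ereal e)"
    proof (intro exI conjI allI impI)
      show "(0::real) < 1 / 2 ^ (2 * k + 4)" by simp
      fix A assume A: "randomized_algorithm A"
      show "ereal (1 / 2 ^ (2 * k + 4)) \<le> Limsup sequentially (\<lambda>n. ereal (eps U A n))"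
      proof (rule ccontr)
        assume "\<not> ?thesis"
        then have "eventually (\<lambda>n. ereal (eps U A n) < ereal (1 / 2 ^ (2 * k + 4))) sequentially"
          by (intro Limsup_lessD) simp
        with k[OF A] show False by simp
      qed
    qed
  qed
qed

end
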